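(* Let $G=\bigoplus_{j=0}^\infty\langle e_j\rangle$, where $u_j:=o(e_j)<\infty$ for every $j\geq 0$. Let $e'_j\in\langle e_j\rangle$ be arbitrary for every $j\geq 0$, and set $H=\bigoplus_{j=0}^\infty\langle e'_j\rangle$. Assume that either (a) there is $j_0\geq 0$ such that $u_{j_0}=u_{j_0+1}=\dots$ and $u_{j_0}$ is divisible by each of $u_0,\dots,u_{j_0-1}$, or (b) $\sup\{u_j: j\geq 0\}=\infty$. Then $G$ admits a complete Hausdorff group topology $\tau$ such that $\mathbf{n}(G,\tau)=H$.
   Context: $o(g)$ is the order of $g$ and $\langle g\rangle$ the cyclic subgroup generated by $g$. For a topological Abelian group $X$, $X^\wedge$ is the group of continuous characters (continuous homomorphisms to the circle group), and $\mathbf{n}(X)=\bigcap_{\chi\in X^\wedge}\ker\chi$ is the von Neumann radical of $X$. *)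

theory Defs
  imports
    "HOL-Analysis.Analysis"
    "HOL-Algebra.Multiplicative_Group"
    "HOL-Algebra.Product_Groups"
    "HOL-Algebra.Free_Abelian_Groups"
begin

text \<open>
  \<open>H\<close> is the internal direct sum of the subgroups \<open>S i\<close>: the summation map from the external
  direct sum of the \<open>S i\<close> is an isomorphism onto \<open>H\<close>. Groups are written multiplicatively; on an
  element of \<open>sum_group\<close>, which has finite support, \<open>gfinprod\<close> is the product of its components.
\<close>

definition internal_direct_sum ::
  "('a, 'b) monoid_scheme \<Rightarrow> 'i set \<Rightarrow> ('i \<Rightarrow> 'a set) \<Rightarrow> 'a set \<Rightarrow> bool"
  where "internal_direct_sum G I S H \<longleftrightarrow>
    subgroup H G \<and> (\<forall>i\<in>I. subgroup (S i) G) \<and>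
    (\<lambda>x. gfinprod G x I) \<in> iso (sum_group I (\<lambda>i. G\<lparr>carrier := S i\<rparr>)) (G\<lparr>carrier := H\<rparr>)"

definition topological_group :: "('a, 'b) monoid_scheme \<Rightarrow> 'a topology \<Rightarrow> bool"
  where "topological_group G T \<longleftrightarrow>
    group G \<and> topspace T = carrier G \<and>
    continuous_map (prod_topology T T) T (\<lambda>(x, y). x \<otimes>\<^bsub>G\<^esub> y) \<and>
    continuous_map T T (\<lambda>x. inv\<^bsub>G\<^esub> x)"

text \<open>
  Completeness with respect to the group uniformity. The library's \<open>cauchy_filter\<close> and \<open>complete\<close>
  belong to the type class \<open>uniform_space\<close> and so do not apply to a topology given as a term.
  Left, right and two-sided uniformities coincide here, since only Abelian groups are considered.
\<close>

definition group_cauchy_filter :: "('a, 'b) monoid_scheme \<Rightarrow> 'a topology \<Rightarrow> 'a filter \<Rightarrow> bool"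
  where "group_cauchy_filter G T F \<longleftrightarrow>
    filtermap (\<lambda>(x, y). x \<otimes>\<^bsub>G\<^esub> inv\<^bsub>G\<^esub> y) (F \<times>\<^sub>F F) \<le> nhdsin T \<one>\<^bsub>G\<^esub>"

definition complete_group_topology :: "('a, 'b) monoid_scheme \<Rightarrow> 'a topology \<Rightarrow> bool"
  where "complete_group_topology G T \<longleftrightarrow>
    (\<forall>F \<le> principal (carrier G). F \<noteq> bot \<longrightarrow> group_cauchy_filter G T F \<longrightarrow>
      (\<exists>x\<in>carrier G. F \<le> nhdsin T x))"

definition circle_group :: "complex monoid"
  where "circle_group = \<lparr>carrier = sphere 0 1, monoid.mult = (*), one = 1\<rparr>"

definition continuous_characters ::
  "('a, 'b) monoid_scheme \<Rightarrow> 'a topology \<Rightarrow> ('a \<Rightarrow> complex) set"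
  where "continuous_characters G T =
    {h \<in> hom G circle_group. continuous_map T (top_of_set (sphere 0 1)) h}"

definition von_Neumann_radical :: "('a, 'b) monoid_scheme \<Rightarrow> 'a topology \<Rightarrow> 'a set"
  where "von_Neumann_radical G T = (\<Inter>h\<in>continuous_characters G T. kernel G circle_group h)"

end

theory Submission
  imports Defs
begin

text \<open>
  The topology is made coarse enough to let no continuous character distinguish elements of
  \<open>H\<close> from the identity, and fine enough to remain Hausdorff and complete. It is the finest
  group topology in which a suitable family tends to the identity. This family consists of the whole
  cyclic groups \<open>\<langle>e i\<rangle>\<close>, as \<open>i\<close> grows, and of the elements
  \<open>g m = e' j \<cdot> e i\<^sub>1 \<cdot> \<dots> \<cdot> e i\<^sub>r\<close>. Here
  \<open>j\<close> depends on \<open>m\<close> and takes every value infinitely often, and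
  \<open>i\<^sub>1, \<dots>, i\<^sub>r\<close> form a block of fresh indices with
  \<open>r > m + 1\<close>.

  \<^emph>\<open>The radical.\<close> The circle has no nontrivial subgroups near \<open>1\<close>. So a
  continuous character \<open>\<xi>\<close> is trivial on almost all
  \<open>\<langle>e i\<rangle>\<close>, and \<open>\<xi> (g m) = \<xi> (e' j)\<close> for large
  \<open>m\<close>. Since \<open>\<xi> (g m)\<close> tends to \<open>1\<close>, this gives
  \<open>\<xi> (e' j) = 1\<close> (lemma \<open>character_target\<close>). Conversely, if the coordinate
  \<open>i\<close> of an element is not in \<open>\<langle>e' i\<rangle>\<close>, a character of the
  cyclic group \<open>\<langle>e i\<rangle>/\<langle>e' i\<rangle>\<close> detects this. Composed with
  the projection it is trivial on almost all of the family and therefore continuous (lemma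
  \<open>coordinate_character\<close>).

  \<^emph>\<open>Hausdorffness.\<close> Small neighbourhoods of the identity consist of products with
  few early factors: at most \<open>m + 1\<close> of them can be \<open>g m\<close>, its inverse, or
  powers of the \<open>e i\<close> with \<open>i\<close> in its block. Take the last \<open>m\<close>
  for which \<open>g m\<close> has a total exponent \<open>c\<close> that does not kill the group. It
  contributes \<open>c\<close> at more than \<open>m + 1\<close> places, and powers of single
  \<open>e i\<close> cannot cancel all of them. So \<open>c\<close> kills some \<open>e i\<close> of the
  block. The blocks consist of indices for which such a \<open>c\<close>, being at most
  \<open>m + 1\<close> in absolute value, kills the whole group, a contradiction (definition
  \<open>robust\<close>). Each of the two conditions on the orders provides infinitely many such
  indices. Hence the \<open>g m\<close> drop out of the product, and the powers of late
  \<open>e i\<close> alone cannot give a fixed nontrivial element (lemma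
  \<open>products_separate\<close>).

  \<^emph>\<open>Completeness.\<close> The family together with the identity is compact and generates
  the group, which is therefore a countable inductive limit of compact sets. For such groups a diagonal
  argument shows that Cauchy filters have cluster points (lemma \<open>complete_base_topology\<close>).
\<close>

section \<open>Group topologies from a base at the identity\<close>

text \<open>
  The translates of the sets \<open>N i\<close> form neighbourhood bases of an Abelian group topology.
  The axioms are the usual ones for a filter base at the identity. The intersection of the
  \<open>N i\<close> may be nontrivial, so the topology need not be Hausdorff.
\<close>

locale nbhd_base = comm_group G for G (structure) +
  fixes N :: "'i \<Rightarrow> 'a set"
  assumes N_subset: "N i \<subseteq> carrier G"
    and N_one: "\<one> \<in> N i"
    and N_inv: "x \<in> N i \<Longrightarrow> inv x \<in> N i"
    and N_mult: "\<exists>j. \<forall>x\<in>N j. \<forall>y\<in>N j. x \<otimes> y \<in> N i"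
    and N_inter: "\<exists>k. N k \<subseteq> N i \<inter> N j"
begin

definition base_topology :: "'a topology" where
  "base_topology = topology (\<lambda>V. V \<subseteq> carrier G \<and> (\<forall>x\<in>V. \<exists>i. x <# N i \<subseteq> V))"

lemma N_carrier: "x \<in> N i \<Longrightarrow> x \<in> carrier G"
  using N_subset by auto

lemma openin_base_topology:
  "openin base_topology V \<longleftrightarrow> V \<subseteq> carrier G \<and> (\<forall>x\<in>V. \<exists>i. x <# N i \<subseteq> V)"
proof -
  have "istopology (\<lambda>V. V \<subseteq> carrier G \<and> (\<forall>x\<in>V. \<exists>i. x <# N i \<subseteq> V))"
    unfolding istopology_def
  proof (intro conjI allI impI ballI)
    fix S T x
    assume S: "S \<subseteq> carrier G \<and> (\<forall>x\<in>S. \<exists>i. x <# N i \<subseteq> S)"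
      and T: "T \<subseteq> carrier G \<and> (\<forall>x\<in>T. \<exists>i. x <# N i \<subseteq> T)"
      and x: "x \<in> S \<inter> T"
    then obtain i j where ij: "x <# N i \<subseteq> S" "x <# N j \<subseteq> T" by blast
    obtain k where "N k \<subseteq> N i \<inter> N j" using N_inter by blast
    then have "x <# N k \<subseteq> S \<inter> T" using ij unfolding l_coset_def by blast
    then show "\<exists>k. x <# N k \<subseteq> S \<inter> T" by blast
  next
    fix \<K> x
    assume K: "\<forall>K\<in>\<K>. K \<subseteq> carrier G \<and> (\<forall>x\<in>K. \<exists>i. x <# N i \<subseteq> K)" and x: "x \<in> \<Union>\<K>"
    then obtain K i where "K \<in> \<K>" "x <# N i \<subseteq> K" by blast
    then show "\<exists>i. x <# N i \<subseteq> \<Union>\<K>" by blast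
  qed auto
  then show ?thesis
    unfolding base_topology_def by (subst topology_inverse') auto
qed

lemma topspace_base_topology [simp]: "topspace base_topology = carrier G"
proof -
  have "openin base_topology (carrier G)"
    unfolding openin_base_topology l_coset_def using N_subset by blast
  then show ?thesis
    by (metis openin_base_topology openin_subset openin_topspace subset_antisym)
qed

text \<open>
  The cosets \<open>x <# N i\<close> need not be open. Their interior consists of the points
  \<open>y\<close> that have a whole coset \<open>y <# N k\<close> inside; it is open because some
  \<open>N j\<close> has its square inside \<open>N k\<close>.
\<close>

lemma coset_nbhd:
  assumes "x \<in> carrier G"
  obtains V where "openin base_topology V" "x \<in> V" "V \<subseteq> x <# N i"
proof
  let ?V = "{y \<in> carrier G. \<exists>k. y <# N k \<subseteq> x <# N i}"
  show "openin base_topology ?V"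
    unfolding openin_base_topology
  proof (intro conjI ballI)
    fix y assume "y \<in> ?V"
    then obtain k where y: "y \<in> carrier G" and k: "y <# N k \<subseteq> x <# N i" by blast
    obtain j where j: "\<And>v w. v \<in> N j \<Longrightarrow> w \<in> N j \<Longrightarrow> v \<otimes> w \<in> N k" using N_mult by meson
    have "z \<in> ?V" if "z \<in> y <# N j" for z
    proof -
      from that obtain v where v: "v \<in> N j" and z: "z = y \<otimes> v" unfolding l_coset_def by blast
      have "z <# N j \<subseteq> y <# N k"
        using v j y by (auto simp: l_coset_def z m_assoc N_carrier)
      then show ?thesis using k y v by (auto simp: z N_carrier)
    qed
    then show "\<exists>i. y <# N i \<subseteq> ?V" by blast
  qed auto
  show "x \<in> ?V" using assms by auto
  show "?V \<subseteq> x <# N i"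
  proof
    fix y assume "y \<in> ?V"
    then obtain k where "y \<in> carrier G" "y <# N k \<subseteq> x <# N i" by blast
    moreover have "y = y \<otimes> \<one>" using \<open>y \<in> carrier G\<close> by simp
    ultimately show "y \<in> x <# N i" using N_one unfolding l_coset_def by blast
  qed
qed

lemma eventually_nhdsin_base_topology:
  assumes "x \<in> carrier G"
  shows "eventually P (nhdsin base_topology x) \<longleftrightarrow> (\<exists>i. \<forall>y\<in>N i. P (x \<otimes> y))"
proof
  assume "eventually P (nhdsin base_topology x)"
  then obtain S where "openin base_topology S" "x \<in> S" "\<forall>y\<in>S. P y"
    using assms by (auto simp: eventually_nhdsin)
  then obtain i where "x <# N i \<subseteq> S" unfolding openin_base_topology by blast
  then show "\<exists>i. \<forall>y\<in>N i. P (x \<otimes> y)"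
    using \<open>\<forall>y\<in>S. P y\<close> unfolding l_coset_def by blast
next
  assume "\<exists>i. \<forall>y\<in>N i. P (x \<otimes> y)"
  then obtain i where i: "\<forall>y\<in>N i. P (x \<otimes> y)" by blast
  obtain V where "openin base_topology V" "x \<in> V" "V \<subseteq> x <# N i"
    using coset_nbhd[OF assms] by blast
  then show "eventually P (nhdsin base_topology x)"
    using i unfolding eventually_nhdsin l_coset_def by blast
qed

lemma topological_group_base_topology: "topological_group G base_topology"
proof -
  have mult: "continuous_map (prod_topology base_topology base_topology) base_topology (\<lambda>(x, y). x \<otimes> y)"
    unfolding continuous_map_def
  proof (intro conjI allI impI)
    fix V assume V: "openin base_topology V"
    show "openin (prod_topology base_topology base_topology)
           {z \<in> topspace (prod_topology base_topology base_topology). (case z of (x, y) \<Rightarrow> x \<otimes> y) \<in> V}"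
      unfolding openin_prod_topology_alt
    proof (intro allI impI)
      fix x y
      assume "(x, y) \<in> {z \<in> topspace (prod_topology base_topology base_topology). (case z of (x, y) \<Rightarrow> x \<otimes> y) \<in> V}"
      then have x: "x \<in> carrier G" and y: "y \<in> carrier G" and xy: "x \<otimes> y \<in> V" by auto
      obtain i where i: "(x \<otimes> y) <# N i \<subseteq> V" using V xy unfolding openin_base_topology by blast
      obtain j where j: "\<And>v w. v \<in> N j \<Longrightarrow> w \<in> N j \<Longrightarrow> v \<otimes> w \<in> N i" using N_mult by meson
      obtain X where X: "openin base_topology X" "x \<in> X" "X \<subseteq> x <# N j"
        using coset_nbhd[OF x] by blast
      obtain Y where Y: "openin base_topology Y" "y \<in> Y" "Y \<subseteq> y <# N j"
        using coset_nbhd[OF y] by blast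
      have "x' \<otimes> y' \<in> V" if "x' \<in> X" "y' \<in> Y" for x' y'
      proof -
        obtain v w where vw: "v \<in> N j" "w \<in> N j" "x' = x \<otimes> v" "y' = y \<otimes> w"
          using \<open>x' \<in> X\<close> \<open>y' \<in> Y\<close> X Y unfolding l_coset_def by blast
        then have "x' \<otimes> y' = (x \<otimes> y) \<otimes> (v \<otimes> w)"
          using x y by (simp add: N_carrier m_ac)
        then show ?thesis using i j vw unfolding l_coset_def by blast
      qed
      moreover have "X \<subseteq> carrier G" "Y \<subseteq> carrier G"
        using X(1) Y(1) openin_base_topology by auto
      ultimately have "X \<times> Y \<subseteq> {z \<in> topspace (prod_topology base_topology base_topology). (case z of (x, y) \<Rightarrow> x \<otimes> y) \<in> V}"
        by auto
      then show "\<exists>U W. openin base_topology U \<and> openin base_topology W \<and> x \<in> U \<and> y \<in> W \<and>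
          U \<times> W \<subseteq> {z \<in> topspace (prod_topology base_topology base_topology). (case z of (x, y) \<Rightarrow> x \<otimes> y) \<in> V}"
        using X(1,2) Y(1,2) by blast
    qed
  qed auto
  have inv: "continuous_map base_topology base_topology (\<lambda>x. inv x)"
    unfolding continuous_map_def
  proof (intro conjI allI impI)
    fix V assume V: "openin base_topology V"
    show "openin base_topology {x \<in> topspace base_topology. inv x \<in> V}"
      unfolding openin_base_topology
    proof (intro conjI ballI)
      fix x assume "x \<in> {x \<in> topspace base_topology. inv x \<in> V}"
      then have x: "x \<in> carrier G" "inv x \<in> V" by auto
      then obtain i where i: "inv x <# N i \<subseteq> V" using V unfolding openin_base_topology by blast
      have "inv (x \<otimes> v) \<in> V" if "v \<in> N i" for v
        using that i x N_inv[OF that] by (auto simp: inv_mult N_carrier l_coset_def)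
      then have "x <# N i \<subseteq> {x \<in> topspace base_topology. inv x \<in> V}"
        using x by (auto simp: l_coset_def N_carrier)
      then show "\<exists>i. x <# N i \<subseteq> {x \<in> topspace base_topology. inv x \<in> V}" by blast
    qed auto
  qed auto
  show ?thesis
    unfolding topological_group_def using mult inv by (simp add: group_axioms)
qed

lemma Hausdorff_base_topology:
  assumes sep: "\<And>x. x \<in> carrier G \<Longrightarrow> x \<noteq> \<one> \<Longrightarrow> \<exists>i. x \<notin> N i"
  shows "Hausdorff_space base_topology"
  unfolding Hausdorff_space_def
proof (intro allI impI)
  fix x y assume "x \<in> topspace base_topology \<and> y \<in> topspace base_topology \<and> x \<noteq> y"
  then have x: "x \<in> carrier G" and y: "y \<in> carrier G" and ne: "x \<noteq> y" by auto
  have "inv x \<otimes> y \<noteq> \<one>" using x y ne by (metis inv_closed inv_equality inv_inv l_cancel_one' l_inv)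
  then obtain i where i: "inv x \<otimes> y \<notin> N i" using sep x y by blast
  obtain j where j: "\<And>v w. v \<in> N j \<Longrightarrow> w \<in> N j \<Longrightarrow> v \<otimes> w \<in> N i" using N_mult by meson
  obtain X where X: "openin base_topology X" "x \<in> X" "X \<subseteq> x <# N j"
    using coset_nbhd[OF x] by blast
  obtain Y where Y: "openin base_topology Y" "y \<in> Y" "Y \<subseteq> y <# N j"
    using coset_nbhd[OF y] by blast
  have "disjnt X Y"
  proof (rule ccontr)
    assume "\<not> disjnt X Y"
    then obtain v w where vw: "v \<in> N j" "w \<in> N j" "x \<otimes> v = y \<otimes> w"
      using X Y unfolding l_coset_def disjnt_def by blast
    have "inv x \<otimes> y = inv x \<otimes> (y \<otimes> w) \<otimes> inv w"
      using vw x y by (simp add: m_assoc N_carrier)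
    also have "\<dots> = v \<otimes> inv w"
      using vw(1,2) x y by (simp add: vw(3)[symmetric] m_assoc[symmetric] N_carrier)
    finally show False using i j vw N_inv by metis
  qed
  then show "\<exists>U V. openin base_topology U \<and> openin base_topology V \<and> x \<in> U \<and> y \<in> V \<and> disjnt U V"
    using X Y by blast
qed

lemma group_cauchy_filter_base_topology:
  assumes "group_cauchy_filter G base_topology F"
  obtains P where "eventually P F" "\<And>x y. P x \<Longrightarrow> P y \<Longrightarrow> x \<otimes> inv y \<in> N i"
proof -
  have "eventually (\<lambda>z. z \<in> N i) (nhdsin base_topology \<one>)"
    by (subst eventually_nhdsin_base_topology) (auto simp: N_carrier)
  then have "eventually (\<lambda>z. z \<in> N i) (filtermap (\<lambda>(x, y). x \<otimes> inv y) (F \<times>\<^sub>F F))"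
    using assms unfolding group_cauchy_filter_def le_filter_def by blast
  then have "eventually (\<lambda>z. (case z of (x, y) \<Rightarrow> x \<otimes> inv y) \<in> N i) (F \<times>\<^sub>F F)"
    by (simp add: eventually_filtermap)
  then show ?thesis
    using that unfolding eventually_prod_same by auto
qed

text \<open>
  In a topological group a Cauchy filter converges to each of its cluster points. If sets of the filter
  that are small of order \<open>N j\<close> met \<open>x <# N j\<close>, they would lie in
  \<open>x <# N i\<close>, where \<open>N i\<close> contains the square of \<open>N j\<close>.
\<close>

lemma cauchy_filter_avoids_nbhd:
  assumes F: "F \<le> principal (carrier G)" and cauchy: "group_cauchy_filter G base_topology F"
    and x: "x \<in> carrier G" and nlim: "\<not> F \<le> nhdsin base_topology x"
  obtains i where "eventually (\<lambda>y. y \<notin> x <# N i) F"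
proof -
  from nlim obtain P where "eventually P (nhdsin base_topology x)" and nP: "\<not> eventually P F"
    by (auto simp: le_filter_def)
  then obtain i where i: "\<forall>v\<in>N i. P (x \<otimes> v)" by (auto simp: eventually_nhdsin_base_topology x)
  obtain j where j: "\<And>v w. v \<in> N j \<Longrightarrow> w \<in> N j \<Longrightarrow> v \<otimes> w \<in> N i" using N_mult by meson
  obtain Q where Q: "eventually Q F" "\<And>x y. Q x \<Longrightarrow> Q y \<Longrightarrow> x \<otimes> inv y \<in> N j"
    using group_cauchy_filter_base_topology[OF cauchy] by metis
  have car: "eventually (\<lambda>y. y \<in> carrier G) F"
    using F by (simp add: le_principal)
  have "y \<notin> x <# N j" if "Q y" "y \<in> carrier G" for y
  proof
    assume "y \<in> x <# N j"
    then obtain v where v: "v \<in> N j" "y = x \<otimes> v" unfolding l_coset_def by blast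
    have "eventually P F"
      using eventually_conj[OF Q(1) car]
    proof eventually_elim
      case (elim z)
      then have z: "z \<in> carrier G" "z \<otimes> inv y \<in> N j" using Q(2) that by auto
      have "z = x \<otimes> (v \<otimes> (z \<otimes> inv y))"
      proof -
        have "x \<otimes> (v \<otimes> (z \<otimes> inv y)) = y \<otimes> (z \<otimes> inv y)"
          using v x z that(2) by (simp add: m_assoc N_carrier)
        also have "\<dots> = z \<otimes> (y \<otimes> inv y)" using z that(2) by (simp only: m_lcomm inv_closed)
        finally show ?thesis using z that(2) by simp
      qed
      then show "P z" using i j v(1) z(2) by metis
    qed
    then show False using nP by simp
  qed
  then have "eventually (\<lambda>y. y \<notin> x <# N j) F"
    using eventually_conj[OF Q(1) car] by (auto elim: eventually_mono)
  then show ?thesis by (rule that)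
qed

end

section \<open>The topology determined by a null family\<close>

text \<open>
  A decreasing sequence of symmetric sets \<open>A n\<close> determines a finest group topology in which
  the \<open>A n\<close> shrink to the identity. Its neighbourhoods of the identity are the sets of all
  finite products \<open>a\<^sub>0 a\<^sub>1 \<dots> a\<^sub>k\<close> with
  \<open>a\<^sub>l \<in> A (\<sigma> l)\<close>, where \<open>\<sigma>\<close> runs through all
  sequences of indices.
\<close>

locale null_family = comm_group G for G (structure) +
  fixes A :: "nat \<Rightarrow> 'a set"
  assumes A_subset: "A n \<subseteq> carrier G"
    and A_one: "\<one> \<in> A n"
    and A_inv: "x \<in> A n \<Longrightarrow> inv x \<in> A n"
    and A_antimono: "m \<le> n \<Longrightarrow> A n \<subseteq> A m"
begin

text \<open>
  The recursion peels off the first factor and shifts the index sequence. This fits both later uses: the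
  tail of a product is a product for the shifted sequence, and the bounds in the separation argument
  improve by one at each shift.
\<close>

inductive is_product :: "(nat \<Rightarrow> nat) \<Rightarrow> 'a \<Rightarrow> bool" where
  one: "is_product \<sigma> \<one>"
| mult: "a \<in> A (\<sigma> 0) \<Longrightarrow> is_product (\<lambda>l. \<sigma> (Suc l)) x \<Longrightarrow> is_product \<sigma> (a \<otimes> x)"

definition products :: "(nat \<Rightarrow> nat) \<Rightarrow> 'a set" where
  "products \<sigma> = {x. is_product \<sigma> x}"

lemma products_one: "\<one> \<in> products \<sigma>"
  by (simp add: products_def is_product.one)

lemma products_mult:
  "a \<in> A (\<sigma> 0) \<Longrightarrow> x \<in> products (\<lambda>l. \<sigma> (Suc l)) \<Longrightarrow> a \<otimes> x \<in> products \<sigma>"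
  by (simp add: products_def is_product.mult)

lemma products_induct [consumes 1, case_names one mult]:
  assumes "x \<in> products \<sigma>" and "\<And>\<sigma>. P \<sigma> \<one>"
    and "\<And>a \<sigma> x. a \<in> A (\<sigma> 0) \<Longrightarrow> x \<in> products (\<lambda>l. \<sigma> (Suc l)) \<Longrightarrow>
      P (\<lambda>l. \<sigma> (Suc l)) x \<Longrightarrow> P \<sigma> (a \<otimes> x)"
  shows "P \<sigma> x"
  using assms unfolding products_def mem_Collect_eq by (rule is_product.induct)

lemma products_factor:
  assumes "x \<in> products \<sigma>"
  obtains a y where "a \<in> A (\<sigma> 0)" "y \<in> products (\<lambda>l. \<sigma> (Suc l))" "x = a \<otimes> y"
  using assms unfolding products_def mem_Collect_eq
  by (cases rule: is_product.cases) (use A_one is_product.one in \<open>metis one_closed l_one\<close>)+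

lemma A_carrier: "a \<in> A n \<Longrightarrow> a \<in> carrier G"
  using A_subset by auto

lemma products_carrier: "x \<in> products \<sigma> \<Longrightarrow> x \<in> carrier G"
  by (induction rule: products_induct) (auto simp: A_carrier)

lemma A_subset_products: "A (\<sigma> 0) \<subseteq> products \<sigma>"
  using products_mult[OF _ products_one] by (fastforce simp: A_carrier)

lemma products_antimono:
  assumes "x \<in> products \<tau>" "\<And>l. \<sigma> l \<le> \<tau> l"
  shows "x \<in> products \<sigma>"
  using assms
proof (induction arbitrary: \<sigma> rule: products_induct)
  case (mult a \<tau> x)
  have "a \<in> A (\<sigma> 0)" using mult.hyps(1) mult.prems A_antimono by blast
  moreover have "x \<in> products (\<lambda>l. \<sigma> (Suc l))" using mult by simp
  ultimately show ?case by (rule products_mult)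
qed (rule products_one)

lemma products_inv: "x \<in> products \<sigma> \<Longrightarrow> inv x \<in> products \<sigma>"
proof (induction rule: products_induct)
  case (mult a \<sigma> x)
  then have "inv a \<otimes> inv x \<in> products \<sigma>" by (intro products_mult A_inv) auto
  then show ?case using mult by (simp add: inv_mult A_carrier products_carrier)
qed (simp add: products_one)

text \<open>
  Interleaving: the \<open>l\<close>-th factors of the two products serve as factors number
  \<open>2 * l\<close> and \<open>2 * l + 1\<close> of the product. The bound is asked for all
  \<open>j\<close> up to \<open>2 * l + 1\<close>, and not only for the last two, so that it also gives
  \<open>\<sigma> l \<le> \<tau> l\<close> when the first product runs out.
\<close>

lemma products_times:
  assumes "x \<in> products \<tau>" "y \<in> products \<tau>" "\<And>l j. j \<le> Suc (2 * l) \<Longrightarrow> \<sigma> j \<le> \<tau> l"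
  shows "x \<otimes> y \<in> products \<sigma>"
  using assms
proof (induction arbitrary: \<sigma> y rule: products_induct)
  case (one \<tau>)
  then show ?case using products_antimono[of y \<tau> \<sigma>] products_carrier by (simp add: le_Suc_eq)
next
  case (mult a \<tau> x)
  have shift: "\<sigma> (Suc (Suc j)) \<le> \<tau> (Suc l)" if "j \<le> Suc (2 * l)" for l j
    using mult.prems(2)[of "Suc (Suc j)" "Suc l"] that by simp
  have "\<sigma> 0 \<le> \<tau> 0" "\<sigma> (Suc 0) \<le> \<tau> 0" using mult.prems(2)[of _ 0] by auto
  then have a: "a \<in> A (\<sigma> 0)" and sub: "A (\<tau> 0) \<subseteq> A (\<sigma> (Suc 0))"
    using mult.hyps A_antimono by blast+
  from mult.prems(1) obtain b y' where b: "b \<in> A (\<tau> 0)"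
    and y': "y' \<in> products (\<lambda>l. \<tau> (Suc l))" and y: "y = b \<otimes> y'"
    by (rule products_factor)
  have "x \<otimes> y' \<in> products (\<lambda>l. \<sigma> (Suc (Suc l)))"
    using mult.IH[OF y'] shift by simp
  then have "b \<otimes> (x \<otimes> y') \<in> products (\<lambda>l. \<sigma> (Suc l))"
    using b sub by (intro products_mult[of b]) auto
  then have "a \<otimes> (b \<otimes> (x \<otimes> y')) \<in> products \<sigma>"
    using a by (intro products_mult[of a]) auto
  moreover have "a \<otimes> x \<otimes> y = a \<otimes> (b \<otimes> (x \<otimes> y'))"
    using a b y' mult.hyps by (simp add: y m_ac A_carrier products_carrier)
  ultimately show ?case by simp
qed

sublocale nbhd_base G products
proof
  fix \<sigma>
  show "products \<sigma> \<subseteq> carrier G" using products_carrier by auto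
  show "\<one> \<in> products \<sigma>" by (rule products_one)
  show "inv x \<in> products \<sigma>" if "x \<in> products \<sigma>" for x using that by (rule products_inv)
  show "\<exists>\<tau>. \<forall>x\<in>products \<tau>. \<forall>y\<in>products \<tau>. x \<otimes> y \<in> products \<sigma>"
  proof (intro exI[of _ "\<lambda>l. Max (\<sigma> ` {..Suc (2 * l)})"] ballI)
    show "x \<otimes> y \<in> products \<sigma>" if "x \<in> products (\<lambda>l. Max (\<sigma> ` {..Suc (2 * l)}))"
      "y \<in> products (\<lambda>l. Max (\<sigma> ` {..Suc (2 * l)}))" for x y
      using that by (rule products_times) auto
  qed
  show "\<exists>\<rho>. products \<rho> \<subseteq> products \<sigma> \<inter> products \<tau>" for \<tau>
    by (rule exI[of _ "\<lambda>l. max (\<sigma> l) (\<tau> l)"]) (auto elim: products_antimono)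
qed

text \<open>
  If \<open>A 0 - A n\<close> is finite for all \<open>n\<close>, then \<open>A 0\<close> is compact,
  and so is the set \<open>words k\<close> of products of \<open>k\<close> elements of
  \<open>A 0\<close>. When the words exhaust the group, it is the inductive limit of countably many
  compact sets.
\<close>

primrec words :: "nat \<Rightarrow> 'a set" where
  "words 0 = {\<one>}"
| "words (Suc k) = A 0 <#> words k"

lemma words_carrier: "x \<in> words k \<Longrightarrow> x \<in> carrier G"
  by (induction k arbitrary: x) (auto simp: set_mult_def A_carrier)

lemma words_mult: "x \<in> words k \<Longrightarrow> y \<in> words l \<Longrightarrow> x \<otimes> y \<in> words (k + l)"
proof (induction k arbitrary: x)
  case 0
  then show ?case by (simp add: words_carrier)
next
  case (Suc k)
  then obtain a x' where a: "a \<in> A 0" "x' \<in> words k" "x = a \<otimes> x'" by (auto simp: set_mult_def)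
  then have "x \<otimes> y = a \<otimes> (x' \<otimes> y)"
    using Suc.prems by (simp add: m_assoc A_carrier words_carrier)
  then show ?case using Suc.IH[OF a(2) Suc.prems(2)] a(1) by (auto simp: set_mult_def)
qed

lemma products_split:
  assumes "x \<in> products \<sigma>"
  obtains v w where "v \<in> words k" "w \<in> products (\<lambda>l. \<sigma> (l + k))" "x = v \<otimes> w"
proof -
  have "\<exists>v w. v \<in> words k \<and> w \<in> products (\<lambda>l. \<sigma> (l + k)) \<and> x = v \<otimes> w"
    using assms
  proof (induction k arbitrary: x \<sigma>)
    case 0
    then show ?case using products_carrier by force
  next
    case (Suc k)
    obtain a x' where a: "a \<in> A (\<sigma> 0)" and x': "x' \<in> products (\<lambda>l. \<sigma> (Suc l))" and x: "x = a \<otimes> x'"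
      using Suc.prems by (rule products_factor)
    obtain v w where vw: "v \<in> words k" "w \<in> products (\<lambda>l. \<sigma> (Suc (l + k)))" "x' = v \<otimes> w"
      using Suc.IH[OF x'] by auto
    have "a \<in> A 0" using a A_antimono by blast
    then have "a \<otimes> v \<in> words (Suc k)" "x = (a \<otimes> v) \<otimes> w"
      using vw by (auto simp: set_mult_def x m_assoc A_carrier words_carrier products_carrier)
    then show ?case using vw(2) by auto
  qed
  then show ?thesis using that by blast
qed

text \<open>
  Groups that are inductive limits of an increasing sequence of compact sets are complete, and the proof
  follows that pattern. Suppose a Cauchy filter \<open>F\<close> has no limit, hence no cluster point.
  By compactness, for each \<open>k\<close> some member of \<open>F\<close> is disjoint from a
  neighbourhood \<open>words k <#> products (\<tau> k)\<close>. One sequence \<open>\<sigma>\<close> is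
  chosen whose tail from \<open>k\<close> on dominates \<open>\<tau> (2 * k)\<close> for every
  \<open>k\<close>. Take a member of \<open>F\<close> that is small of order
  \<open>products \<sigma>\<close> and a word \<open>s\<close> of length \<open>k\<close> in it. Then
  each element of this member is \<open>s\<close> times \<open>k\<close> letters times an element of
  \<open>products (\<tau> (2 * k))\<close>, so it lies in the neighbourhood that belongs to
  \<open>2 * k\<close>, although some member of \<open>F\<close> is disjoint from it.
\<close>

lemma complete_base_topology:
  assumes fin: "\<And>n. finite (A 0 - A n)"
    and gen: "\<And>x. x \<in> carrier G \<Longrightarrow> \<exists>k. x \<in> words k"
  shows "complete_group_topology G base_topology"
  unfolding complete_group_topology_def
proof (intro allI impI, rule ccontr)
  fix F assume F: "F \<le> principal (carrier G)" and nbot: "F \<noteq> bot"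
    and cauchy: "group_cauchy_filter G base_topology F"
    and nlim: "\<not> (\<exists>x\<in>carrier G. F \<le> nhdsin base_topology x)"
  \<comment> \<open>The compactness step, by induction on the word length and uniformly in a translation \<open>x\<close>: the
    first letters in \<open>A (\<sigma> 0)\<close> are absorbed into the neighbourhood, and finitely many remain.\<close>
  have avoid: "\<exists>\<sigma>. eventually (\<lambda>y. \<forall>z\<in>words k. \<forall>v\<in>products \<sigma>. y \<noteq> x \<otimes> z \<otimes> v) F"
    if "x \<in> carrier G" for x k
    using that
  proof (induction k arbitrary: x)
    case 0
    then obtain \<sigma> where "eventually (\<lambda>y. y \<notin> x <# products \<sigma>) F"
      using cauchy_filter_avoids_nbhd[OF F cauchy] nlim by metis
    then show ?case using 0 by (intro exI[of _ \<sigma>]) (auto elim!: eventually_mono simp: l_coset_def)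
  next
    case (Suc k)
    obtain \<sigma> where \<sigma>: "eventually (\<lambda>y. \<forall>z\<in>words k. \<forall>v\<in>products \<sigma>. y \<noteq> x \<otimes> z \<otimes> v) F"
      using Suc by blast
    let ?D = "A 0 - A (\<sigma> 0)"
    have "\<forall>a\<in>?D. \<exists>\<tau>. eventually (\<lambda>y. \<forall>z\<in>words k. \<forall>v\<in>products \<tau>. y \<noteq> x \<otimes> a \<otimes> z \<otimes> v) F"
      using Suc by (auto simp: A_carrier)
    then obtain \<tau> where \<tau>: "\<And>a. a \<in> ?D \<Longrightarrow>
        eventually (\<lambda>y. \<forall>z\<in>words k. \<forall>v\<in>products (\<tau> a). y \<noteq> x \<otimes> a \<otimes> z \<otimes> v) F"
      by (elim bchoice[THEN exE]) blast
    define \<rho> where "\<rho> l = Max (insert (\<sigma> (Suc l)) ((\<lambda>a. \<tau> a l) ` ?D))" for l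
    have \<rho>\<sigma>: "\<sigma> (Suc l) \<le> \<rho> l" for l
      unfolding \<rho>_def using fin by (intro Max_ge) auto
    have \<rho>\<tau>: "\<tau> a l \<le> \<rho> l" if "a \<in> ?D" for a l
      unfolding \<rho>_def using fin that by (intro Max_ge) auto
    have "eventually (\<lambda>y. \<forall>a\<in>?D. \<forall>z\<in>words k. \<forall>v\<in>products (\<tau> a). y \<noteq> x \<otimes> a \<otimes> z \<otimes> v) F"
      using \<tau> fin by (intro eventually_ball_finite) auto
    with \<sigma> have "eventually (\<lambda>y. \<forall>z\<in>words (Suc k). \<forall>v\<in>products \<rho>. y \<noteq> x \<otimes> z \<otimes> v) F"
    proof eventually_elim
      case (elim y)
      show ?case
      proof (intro ballI)
        fix z v assume "z \<in> words (Suc k)" and v: "v \<in> products \<rho>"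
        then obtain a z' where a: "a \<in> A 0" and z': "z' \<in> words k" and z: "z = a \<otimes> z'"
          by (auto simp: set_mult_def)
        have car: "a \<in> carrier G" "z' \<in> carrier G" "v \<in> carrier G"
          using a z' v by (auto simp: A_carrier words_carrier products_carrier)
        show "y \<noteq> x \<otimes> z \<otimes> v"
        proof (cases "a \<in> A (\<sigma> 0)")
          case True
          have "v \<in> products (\<lambda>l. \<sigma> (Suc l))" using v \<rho>\<sigma> by (rule products_antimono)
          with True have "a \<otimes> v \<in> products \<sigma>" by (rule products_mult)
          then have "y \<noteq> x \<otimes> z' \<otimes> (a \<otimes> v)" using elim(1) z' by blast
          then show ?thesis using car Suc.prems by (simp add: z m_ac)
        next
          case False
          then have D: "a \<in> ?D" using a by simp
          have "v \<in> products (\<tau> a)" using v \<rho>\<tau>[OF D] by (rule products_antimono)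
          then have "y \<noteq> x \<otimes> a \<otimes> z' \<otimes> v" using elim(2) D z' by blast
          then show ?thesis using car Suc.prems by (simp add: z m_ac)
        qed
      qed
    qed
    then show ?case by blast
  qed
  have "\<exists>\<sigma>. eventually (\<lambda>y. \<forall>z\<in>words k. \<forall>v\<in>products \<sigma>. y \<noteq> z \<otimes> v) F" for k
  proof -
    obtain \<sigma> where "eventually (\<lambda>y. \<forall>z\<in>words k. \<forall>v\<in>products \<sigma>. y \<noteq> \<one> \<otimes> z \<otimes> v) F"
      using avoid[OF one_closed] by blast
    then show ?thesis
      by (intro exI[of _ \<sigma>]) (auto elim!: eventually_mono simp: words_carrier)
  qed
  then obtain \<tau> where \<tau>: "\<And>k. eventually (\<lambda>y. \<forall>z\<in>words k. \<forall>v\<in>products (\<tau> k). y \<noteq> z \<otimes> v) F"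
    using choice[of "\<lambda>k \<sigma>. eventually (\<lambda>y. \<forall>z\<in>words k. \<forall>v\<in>products \<sigma>. y \<noteq> z \<otimes> v) F"] by blast
  \<comment> \<open>For each \<open>n\<close> only the finitely many conditions with \<open>k \<le> n\<close> concern \<open>\<sigma> n\<close>.\<close>
  define \<sigma> where "\<sigma> n = Max ((\<lambda>k. \<tau> (k + k) (n - k)) ` {..n})" for n
  have \<sigma>: "\<tau> (k + k) l \<le> \<sigma> (l + k)" for k l
  proof -
    have "\<tau> (k + k) (l + k - k) \<le> \<sigma> (l + k)"
      unfolding \<sigma>_def by (intro Max_ge finite_imageI imageI finite_atMost) simp
    then show ?thesis by simp
  qed
  obtain Q where Q: "eventually Q F" "\<And>x y. Q x \<Longrightarrow> Q y \<Longrightarrow> x \<otimes> inv y \<in> products \<sigma>"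
    using group_cauchy_filter_base_topology[OF cauchy] by metis
  have car: "eventually (\<lambda>y. y \<in> carrier G) F"
    using F by (simp add: le_principal)
  obtain s where s: "Q s" "s \<in> carrier G"
    using eventually_happens'[OF nbot eventually_conj[OF Q(1) car]] by blast
  obtain k where k: "s \<in> words k" using gen s by blast
  obtain t where t: "Q t" "t \<in> carrier G" "\<forall>z\<in>words (k + k). \<forall>v\<in>products (\<tau> (k + k)). t \<noteq> z \<otimes> v"
    using eventually_happens'[OF nbot eventually_conj[OF eventually_conj[OF Q(1) car] \<tau>[of "k + k"]]]
    by blast
  obtain v w where v: "v \<in> words k" and w: "w \<in> products (\<lambda>l. \<sigma> (l + k))" and vw: "t \<otimes> inv s = v \<otimes> w"
    using products_split[OF Q(2)[OF t(1) s(1)]] by metis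
  have "w \<in> products (\<tau> (k + k))" using w \<sigma> by (rule products_antimono)
  moreover have "t = (s \<otimes> v) \<otimes> w"
  proof -
    have "t = s \<otimes> (t \<otimes> inv s)" using t(2) s(2) by (metis m_lcomm inv_closed r_inv r_one)
    then show ?thesis using v w s(2) by (simp add: vw m_assoc words_carrier products_carrier)
  qed
  ultimately show False using t(3) words_mult[OF k v] by blast
qed

end

section \<open>Indices at which small multiples do not vanish\<close>

text \<open>
  The indices \<open>i\<close> such that an integer \<open>c\<close> with
  \<open>\<bar>c\<bar> \<le> m + 1\<close> kills \<open>e i\<close> only if \<open>c\<close> kills the
  whole group. The two alternatives for the sequence of orders serve only to provide infinitely many of
  them.
\<close>

definition robust :: "(nat \<Rightarrow> nat) \<Rightarrow> nat \<Rightarrow> nat set" where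
  "robust u m = {i. \<forall>c. \<bar>c\<bar> \<le> int (Suc m) \<longrightarrow> int (u i) dvd c \<longrightarrow> (\<forall>j. int (u j) dvd c)}"

text \<open>
  If the orders are eventually equal to a common multiple \<open>u j0\<close> of all of them, an integer
  that kills some \<open>e j\<close> with \<open>j \<ge> j0\<close> kills everything. If they are
  unbounded, infinitely many exceed \<open>m + 1\<close>, and then only \<open>c = 0\<close> qualifies.
\<close>

lemma infinite_robust:
  assumes "(\<exists>j0. (\<forall>j\<ge>j0. u j = u j0) \<and> (\<forall>j<j0. u j dvd u j0)) \<or> \<not> bdd_above (range u)"
  shows "infinite (robust u m)"
  using assms
proof
  assume "\<exists>j0. (\<forall>j\<ge>j0. u j = u j0) \<and> (\<forall>j<j0. u j dvd u j0)"
  then obtain j0 where j0: "\<And>j. j0 \<le> j \<Longrightarrow> u j = u j0" "\<And>j. j < j0 \<Longrightarrow> u j dvd u j0" by blast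
  then have dvd_j0: "u j dvd u j0" for j by (metis dvd_refl not_le)
  have "j \<in> robust u m" if "j0 \<le> j" for j
    unfolding robust_def
  proof (intro CollectI allI impI)
    fix c k assume "int (u j) dvd c"
    then have "int (u j0) dvd c" using j0(1)[OF that] by simp
    then show "int (u k) dvd c" using dvd_j0[of k] by (meson dvd_trans int_dvd_int_iff)
  qed
  then have "{j0..} \<subseteq> robust u m" by auto
  then show ?thesis using infinite_Ici infinite_super by blast
next
  assume nb: "\<not> bdd_above (range u)"
  have sub: "{i. Suc m < u i} \<subseteq> robust u m"
  proof (intro subsetI)
    fix i assume "i \<in> {i. Suc m < u i}"
    then have "c = 0" if "\<bar>c\<bar> \<le> int (Suc m)" "int (u i) dvd c" for c
      using that dvd_imp_le_int[of c "int (u i)"] by fastforce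
    then show "i \<in> robust u m" by (fastforce simp: robust_def)
  qed
  show ?thesis
  proof
    assume "finite (robust u m)"
    then have fin: "finite {i. Suc m < u i}" using sub finite_subset by blast
    have "range u \<subseteq> {..Suc m} \<union> u ` {i. Suc m < u i}" by (auto simp: not_less[symmetric])
    then have "finite (range u)" using fin finite_subset by blast
    then show False using nb by (simp add: bdd_above_nat)
  qed
qed

lemma exists_block_bounds:
  assumes inf: "\<And>m. infinite (S m :: nat set)"
  obtains p where "p 0 = 0" "strict_mono p" "\<And>m. Suc m < card (S m \<inter> {p m<..<p (Suc m)})"
proof -
  have "\<exists>q > r. Suc m < card (S m \<inter> {r<..<q})" for r m :: nat
  proof -
    have "infinite (S m - {..r})" using inf by (simp add: Diff_infinite_finite)
    then obtain B where B: "finite B" "card B = Suc (Suc m)" "B \<subseteq> S m - {..r}"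
      using infinite_arbitrarily_large by blast
    let ?q = "Suc (Max B)"
    have sub: "B \<subseteq> S m \<inter> {r<..<?q}"
      using B by (auto simp: less_Suc_eq_le not_le)
    then have "card B \<le> card (S m \<inter> {r<..<?q})" by (intro card_mono) auto
    moreover have "r < ?q"
    proof -
      have "B \<noteq> {}" using B(2) by auto
      then obtain b where "b \<in> B" by blast
      then have "r < b" "b < ?q" using sub by auto
      then show ?thesis by simp
    qed
    ultimately show ?thesis using B(2) by (intro exI[of _ ?q]) auto
  qed
  then have "\<exists>p. \<forall>n. (n = 0 \<longrightarrow> p n = 0) \<and> p n < p (Suc n) \<and> Suc n < card (S n \<inter> {p n<..<p (Suc n)})"
    using dependent_nat_choice[of "\<lambda>n r. n = 0 \<longrightarrow> r = 0"
        "\<lambda>n r q. r < q \<and> Suc n < card (S n \<inter> {r<..<q})"]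
    by auto
  then obtain p where "p 0 = 0" "\<And>n. p n < p (Suc n)" "\<And>n. Suc n < card (S n \<inter> {p n<..<p (Suc n)})"
    by blast
  then show ?thesis using that strict_mono_Suc_iff by blast
qed

section \<open>Coordinates in a direct sum of finite cyclic groups\<close>

text \<open>
  The projections are the components of the inverse of the summation isomorphism.
\<close>

lemma (in comm_group) internal_direct_sum_projections:
  fixes S :: "'i \<Rightarrow> 'a set"
  assumes ds: "internal_direct_sum G UNIV S (carrier G)"
  obtains \<pi> where "\<And>i. \<pi> i \<in> hom G G"
    and "\<And>i x. x \<in> carrier G \<Longrightarrow> \<pi> i x \<in> S i"
    and "\<And>i j x. x \<in> S i \<Longrightarrow> \<pi> j x = (if j = i then x else \<one>)"
    and "\<And>x. x \<in> carrier G \<Longrightarrow> finite {i. \<pi> i x \<noteq> \<one>}"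
    and "\<And>x. x \<in> carrier G \<Longrightarrow> x = gfinprod G (\<lambda>i. \<pi> i x) UNIV"
proof -
  let ?S = "sum_group UNIV (\<lambda>i. G\<lparr>carrier := S i\<rparr>)"
  define \<phi> where "\<phi> = (\<lambda>x :: 'i \<Rightarrow> 'a. gfinprod G x UNIV)"
  define \<psi> where "\<psi> = inv_into (carrier ?S) \<phi>"
  have sub: "subgroup (S i) G" for i using ds by (simp add: internal_direct_sum_def)
  have grp: "group (G\<lparr>carrier := S i\<rparr>)" for i
    using subgroup.subgroup_is_group[OF sub is_group] .
  have \<phi>: "\<phi> \<in> iso ?S G" using ds by (simp add: internal_direct_sum_def \<phi>_def)
  have \<psi>: "\<psi> \<in> iso G ?S"
    unfolding \<psi>_def using grp by (intro group.iso_set_sym[OF _ \<phi>]) simp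
  have carS: "carrier ?S = {x. (\<forall>i. x i \<in> S i) \<and> finite {i. x i \<noteq> \<one>}}"
    using grp by (subst carrier_sum_group) auto
  have \<psi>_car: "\<psi> x \<in> carrier ?S" if "x \<in> carrier G" for x
    using \<psi> that by (auto simp: iso_def hom_def)
  show ?thesis
  proof (rule that[of "\<lambda>i x. \<psi> x i"])
    show "(\<lambda>x. \<psi> x i) \<in> hom G G" for i
    proof (rule homI)
      show "\<psi> x i \<in> carrier G" if "x \<in> carrier G" for x
        using \<psi>_car[OF that] subgroup.subset[OF sub[of i]] by (auto simp: carS)
      show "\<psi> (x \<otimes> y) i = \<psi> x i \<otimes> \<psi> y i" if "x \<in> carrier G" "y \<in> carrier G" for x y
        using hom_mult[of \<psi> G ?S x y] \<psi> that by (simp add: iso_def)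
    qed
    show "\<psi> x i \<in> S i" "finite {i. \<psi> x i \<noteq> \<one>}" if "x \<in> carrier G" for i x
      using \<psi>_car[OF that] by (auto simp: carS)
    show "x = gfinprod G (\<lambda>i. \<psi> x i) UNIV" if "x \<in> carrier G" for x
    proof -
      have "\<phi> (\<psi> x) = x"
        unfolding \<psi>_def using \<phi> that f_inv_into_f[of x \<phi> "carrier ?S"]
        by (simp add: iso_def bij_betw_def)
      then show ?thesis by (simp add: \<phi>_def)
    qed
    show "\<psi> x j = (if j = i then x else \<one>)" if x: "x \<in> S i" for i j x
    proof -
      let ?s = "\<lambda>j. if j = i then x else \<one>"
      have xc: "x \<in> carrier G" using subgroup.subset[OF sub] x by auto
      have s: "?s \<in> carrier ?S" using x subgroup.one_closed[OF sub] by (auto simp: carS)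
      have "\<phi> ?s = gfinprod G ?s {i}"
        unfolding \<phi>_def using xc by (intro gfinprod_mono_neutral_cong_right) auto
      then have "\<phi> ?s = x" using xc by simp
      moreover have "inv_into (carrier ?S) \<phi> (\<phi> ?s) = ?s"
        using \<phi> s by (intro inv_into_f_f) (simp_all add: iso_def bij_betw_def)
      ultimately have "\<psi> x = ?s" by (simp add: \<psi>_def)
      then show ?thesis by simp
    qed
  qed
qed

lemma (in comm_group) gfinprod_in_subgroup:
  assumes K: "subgroup K G" and x: "\<And>i. x i \<in> K"
  shows "gfinprod G x I \<in> K"
proof -
  have sub: "x i \<in> carrier G" for i using x subgroup.subset[OF K] by blast
  have "finprod G x J \<in> K" if "finite J" for J
    using that
    by (induction J) (auto simp: subgroup.one_closed[OF K] subgroup.m_closed[OF K] x sub)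
  then show ?thesis
    by (auto simp: gfinprod_def subgroup.one_closed[OF K])
qed

text \<open>
  \<open>\<kappa> x i\<close> is the exponent of \<open>e i\<close> in \<open>x\<close>, reduced modulo
  the order \<open>u i\<close>.
\<close>

locale coordinates = comm_group G for G (structure) +
  fixes e :: "nat \<Rightarrow> 'a" and u :: "nat \<Rightarrow> nat" and \<kappa> :: "'a \<Rightarrow> nat \<Rightarrow> int"
  assumes e_carrier: "e i \<in> carrier G"
    and u_pos: "0 < u i"
    and \<kappa>_mult: "x \<in> carrier G \<Longrightarrow> y \<in> carrier G \<Longrightarrow> \<kappa> (x \<otimes> y) i = (\<kappa> x i + \<kappa> y i) mod int (u i)"
    and \<kappa>_pow: "\<kappa> (e j [^] (n :: int)) i = (if i = j then n mod int (u i) else 0)"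
    and \<kappa>_mod: "\<kappa> x i mod int (u i) = \<kappa> x i"
    and \<kappa>_finite: "x \<in> carrier G \<Longrightarrow> finite {i. \<kappa> x i \<noteq> 0}"
    and \<kappa>_zero: "x \<in> carrier G \<Longrightarrow> (\<And>i. \<kappa> x i = 0) \<Longrightarrow> x = \<one>"
begin

lemma \<kappa>_one: "\<kappa> \<one> i = 0"
  using \<kappa>_pow[of i 0 i] by simp

lemma \<kappa>_inv:
  assumes "x \<in> carrier G"
  shows "\<kappa> (inv x) i = (- \<kappa> x i) mod int (u i)"
proof -
  have "(\<kappa> (inv x) i + \<kappa> x i) mod int (u i) = 0"
    using \<kappa>_mult[of "inv x" x i] assms by (simp add: \<kappa>_one)
  then have "(\<kappa> (inv x) i + \<kappa> x i + - \<kappa> x i) mod int (u i) = (0 + - \<kappa> x i) mod int (u i)"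
    by (metis mod_add_left_eq mod_0)
  then show ?thesis using \<kappa>_mod[of "inv x" i] by simp
qed

lemma \<kappa>_eqI:
  assumes "x \<in> carrier G" "y \<in> carrier G" "\<And>i. \<kappa> x i = \<kappa> y i"
  shows "x = y"
proof -
  have "inv x \<otimes> y = \<one>"
    using assms by (intro \<kappa>_zero) (simp_all add: \<kappa>_mult \<kappa>_inv mod_simps)
  then show ?thesis using assms by (metis inv_equality inv_inv inv_closed)
qed

lemma \<kappa>_finprod_e:
  "finite B \<Longrightarrow> \<kappa> (finprod G e B) i = (if i \<in> B then 1 else 0) mod int (u i)"
proof (induction B rule: finite_induct)
  case empty
  then show ?case by (simp add: \<kappa>_one)
next
  case (insert b B)
  have "\<kappa> (e b) i = (if i = b then 1 mod int (u i) else 0)"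
    using \<kappa>_pow[of b 1 i] e_carrier by simp
  then show ?case using insert
    by (auto simp: \<kappa>_mult e_carrier finprod_closed mod_simps)
qed

lemma finite_powers: "finite (range (\<lambda>n :: int. e i [^] n))"
proof (rule finite_subset)
  show "range (\<lambda>n :: int. e i [^] n) \<subseteq> (\<lambda>n. e i [^] n) ` {0..<int (u i)}"
  proof
    fix x assume "x \<in> range (\<lambda>n :: int. e i [^] n)"
    then obtain n :: int where x: "x = e i [^] n" by blast
    have "x = e i [^] (n mod int (u i))"
      unfolding x by (rule \<kappa>_eqI) (auto simp: e_carrier \<kappa>_pow)
    then show "x \<in> (\<lambda>n. e i [^] n) ` {0..<int (u i)}" using u_pos by auto
  qed
qed simp

end

section \<open>The null family of a block sequence\<close>

text \<open>
  The interval \<open>{p m<..<p (Suc m)}\<close> contains the \<open>m\<close>-th block, a set of at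
  least \<open>m + 2\<close> robust indices, and \<open>e j [^] a j\<close> is the element that has to
  be killed by all continuous characters.
\<close>

locale block_sequence = coordinates G e u \<kappa>
  for G (structure) and e :: "nat \<Rightarrow> 'a" and u :: "nat \<Rightarrow> nat" and \<kappa> :: "'a \<Rightarrow> nat \<Rightarrow> int" +
  fixes a :: "nat \<Rightarrow> int" and p :: "nat \<Rightarrow> nat"
  assumes p_0: "p 0 = 0"
    and p_mono: "strict_mono p"
    and p_robust: "Suc m < card (robust u m \<inter> {p m<..<p (Suc m)})"
begin

definition block :: "nat \<Rightarrow> nat set" where
  "block m = robust u m \<inter> {p m<..<p (Suc m)}"

text \<open>
  The pairing function makes every \<open>j\<close> the target of infinitely many \<open>m\<close>, and
  \<open>target m \<le> m\<close> puts the target below the block \<open>m\<close>.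
\<close>

definition target :: "nat \<Rightarrow> nat" where
  "target m = fst (prod_decode m)"

definition g :: "nat \<Rightarrow> 'a" where
  "g m = e (target m) [^] a (target m) \<otimes> finprod G e (block m)"

text \<open>
  Whole cyclic groups \<open>\<langle>e i\<rangle>\<close> tend to the identity, which forces a
  continuous character to be trivial on almost all of them. Then the convergence of \<open>g m\<close>
  forces it to be trivial on the targets as well.
\<close>

definition A :: "nat \<Rightarrow> 'a set" where
  "A n = {e i [^] (k :: int) | i k. p n \<le> i} \<union> g ` {n..} \<union> (\<lambda>m. inv (g m)) ` {n..}"

text \<open>
  The coordinates of \<open>g m\<close> before reduction.
\<close>

definition \<gamma> :: "nat \<Rightarrow> nat \<Rightarrow> int" where
  "\<gamma> m i = (if i \<in> block m then 1 else 0) + (if i = target m then a i else 0)"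

lemma finite_block: "finite (block m)"
  by (simp add: block_def)

lemma target_le: "target m \<le> m"
  unfolding target_def by (metis le_prod_encode_1 prod.collapse prod_decode_inverse)

lemma p_ge: "m \<le> p m"
  using p_mono by (rule strict_mono_imp_increasing)

lemma p_le: "m \<le> n \<Longrightarrow> p m \<le> p n"
  using p_mono by (simp add: strict_mono_less_eq)

lemma finprod_e_carrier: "finprod G e B \<in> carrier G"
  by (rule finprod_closed) (auto simp: e_carrier)

lemma g_carrier: "g m \<in> carrier G"
  by (simp add: g_def e_carrier finprod_e_carrier)

lemma \<kappa>_g: "\<kappa> (g m) i = \<gamma> m i mod int (u i)"
  by (auto simp: g_def \<gamma>_def \<kappa>_mult e_carrier finprod_e_carrier \<kappa>_finprod_e finite_block \<kappa>_pow mod_simps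
      add.commute)

lemma A_cases:
  assumes "x \<in> A n"
  obtains (power) i k where "p n \<le> i" "x = e i [^] (k :: int)"
  | (g) m where "n \<le> m" "x = g m"
  | (inv_g) m where "n \<le> m" "x = inv (g m)"
  using assms by (auto simp: A_def)

sublocale null_family G A
proof
  fix m n
  show "A n \<subseteq> carrier G" by (auto simp: A_def e_carrier g_carrier)
  show "\<one> \<in> A n"
  proof -
    have "\<one> = e (p n) [^] (0 :: int)" by simp
    then show ?thesis unfolding A_def by blast
  qed
  show "inv x \<in> A n" if "x \<in> A n" for x
    using that
  proof (cases rule: A_cases)
    case (power i k)
    then have "inv x = e i [^] (- k)" by (simp add: e_carrier int_pow_neg)
    then show ?thesis using power unfolding A_def by blast
  qed (auto simp: A_def g_carrier)
  show "A n \<subseteq> A m" if "m \<le> n"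
    using p_le[OF that] that by (fastforce simp: A_def)
qed

lemma finite_A_diff: "finite (A 0 - A n)"
proof (rule finite_subset)
  show "A 0 - A n \<subseteq> (\<Union>i<p n. range (\<lambda>k :: int. e i [^] k)) \<union> g ` {..<n} \<union> (\<lambda>m. inv (g m)) ` {..<n}"
  proof
    fix x assume "x \<in> A 0 - A n"
    then have "x \<in> A 0" and nA: "x \<notin> A n" by auto
    from this(1) show "x \<in> (\<Union>i<p n. range (\<lambda>k :: int. e i [^] k)) \<union> g ` {..<n} \<union> (\<lambda>m. inv (g m)) ` {..<n}"
    proof (cases rule: A_cases)
      case (power i k)
      then have "i < p n" using nA unfolding A_def by (auto simp: not_le[symmetric])
      then show ?thesis using power by blast
    next
      case (g m)
      then have "m < n" using nA unfolding A_def by (auto simp: not_le[symmetric])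
      then show ?thesis using g by blast
    next
      case (inv_g m)
      then have "m < n" using nA unfolding A_def by (auto simp: not_le[symmetric])
      then show ?thesis using inv_g by blast
    qed
  qed
qed (auto simp: finite_powers)

text \<open>
  An induction on the support; each coordinate costs one letter, as \<open>p 0 = 0\<close> puts all
  powers of all \<open>e i\<close> into \<open>A 0\<close>.
\<close>

lemma words_exhaust:
  assumes "x \<in> carrier G"
  shows "\<exists>k. x \<in> words k"
proof -
  have "\<exists>k. x \<in> words k" if "finite I" "x \<in> carrier G" "{i. \<kappa> x i \<noteq> 0} \<subseteq> I" for I x
    using that
  proof (induction I arbitrary: x rule: finite_induct)
    case empty
    then have "x = \<one>" by (intro \<kappa>_zero) auto
    then have "x \<in> words 0" by simp
    then show ?case by blast
  next
    case (insert i I)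
    let ?y = "e i [^] (- \<kappa> x i) \<otimes> x"
    have y: "?y \<in> carrier G" using insert by (simp add: e_carrier)
    have "\<kappa> ?y j = (if j = i then 0 else \<kappa> x j)" for j
      using insert by (simp add: \<kappa>_mult e_carrier \<kappa>_pow \<kappa>_mod mod_simps)
    then have "{j. \<kappa> ?y j \<noteq> 0} \<subseteq> I" using insert.prems(2) by auto
    then obtain k where k: "?y \<in> words k" using insert.IH[OF y] by blast
    have "e i [^] \<kappa> x i \<in> A 0" unfolding A_def using p_0 by auto
    moreover have "x = e i [^] \<kappa> x i \<otimes> ?y"
      using insert.prems(1) by (simp add: e_carrier int_pow_neg m_assoc[symmetric])
    ultimately have "x \<in> words (Suc k)" using k by (auto simp: set_mult_def)
    then show ?case by blast
  qed
  then show ?thesis using assms \<kappa>_finite by blast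
qed

lemma complete: "complete_group_topology G base_topology"
  using finite_A_diff words_exhaust by (rule complete_base_topology)

section \<open>Separation of points\<close>

text \<open>
  This is what remains of a factorization \<open>x = a\<^sub>0 a\<^sub>1 \<dots> a\<^sub>k\<close> with
  \<open>a\<^sub>l \<in> A (N + l)\<close> after equal factors have been collected: \<open>c m\<close>
  is the total exponent of \<open>g m\<close>, and \<open>y\<close> holds the exponents that come from
  powers of the \<open>e i\<close>. At most \<open>m + 1 - N\<close> factors satisfy
  \<open>N + l \<le> m\<close>. This bounds both \<open>\<bar>c m\<bar>\<close> and the number of
  entries of \<open>y\<close> below \<open>p (Suc m)\<close>. Asking for the formula for all
  \<open>l \<ge> L\<close> expresses that \<open>c m\<close> contributes nothing for
  \<open>m \<ge> L\<close>.
\<close>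

definition represents :: "nat \<Rightarrow> 'a \<Rightarrow> (nat \<Rightarrow> int) \<Rightarrow> (nat \<Rightarrow> int) \<Rightarrow> nat \<Rightarrow> bool" where
  "represents N x c y L \<longleftrightarrow>
    (\<forall>i. \<forall>l\<ge>L. \<kappa> x i = ((\<Sum>m<l. c m * \<gamma> m i) + y i) mod int (u i)) \<and>
    (\<forall>m. \<bar>c m\<bar> \<le> int (Suc m - N)) \<and>
    (\<forall>m. card {i. i < p (Suc m) \<and> y i \<noteq> 0} \<le> Suc m - N) \<and>
    (\<forall>i<p N. y i = 0)"

lemma represents_power:
  assumes x: "x \<in> carrier G" and rep: "represents (Suc N) x c y L" and k: "p N \<le> k"
  shows "represents N (e k [^] (n :: int) \<otimes> x) c (y(k := y k + n)) L"
  unfolding represents_def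
proof (intro conjI allI impI)
  fix i l assume "L \<le> l"
  then have "\<kappa> x i = ((\<Sum>m<l. c m * \<gamma> m i) + y i) mod int (u i)"
    using rep by (simp add: represents_def)
  then show "\<kappa> (e k [^] n \<otimes> x) i = ((\<Sum>m<l. c m * \<gamma> m i) + (y(k := y k + n)) i) mod int (u i)"
    using x by (cases "i = k") (simp_all add: \<kappa>_mult e_carrier \<kappa>_pow mod_simps, simp add: ac_simps)
next
  fix m
  have "\<bar>c m\<bar> \<le> int (Suc m - Suc N)" using rep by (simp add: represents_def)
  then show "\<bar>c m\<bar> \<le> int (Suc m - N)" by linarith
next
  fix m
  let ?Y = "{i. i < p (Suc m) \<and> y i \<noteq> 0}"
  let ?Y' = "{i. i < p (Suc m) \<and> (y(k := y k + n)) i \<noteq> 0}"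
  have Y: "finite ?Y" "card ?Y \<le> Suc m - Suc N"
    using rep by (auto simp: represents_def)
  show "card ?Y' \<le> Suc m - N"
  proof (cases "k < p (Suc m)")
    case True
    then have "p N < p (Suc m)" using k by simp
    then have "N \<le> m" using p_mono by (simp add: strict_mono_less)
    have "card ?Y' \<le> card (insert k ?Y)" using Y(1) by (intro card_mono) auto
    also have "\<dots> \<le> Suc (card ?Y)" by (rule card_insert_le_m1) auto
    finally show ?thesis using Y(2) \<open>N \<le> m\<close> by simp
  next
    case False
    then have "?Y' = ?Y" by auto
    then show ?thesis using Y(2) by simp
  qed
next
  fix i assume "i < p N"
  moreover then have "i < p (Suc N)" using p_le[of N "Suc N"] by simp
  ultimately show "(y(k := y k + n)) i = 0"
    using rep k by (auto simp: represents_def)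
qed

lemma represents_g:
  assumes x: "x \<in> carrier G" and rep: "represents (Suc N) x c y L" and k: "N \<le> k"
    and b: "b \<in> carrier G" "\<And>i. \<kappa> b i = (s * \<gamma> k i) mod int (u i)" and s: "\<bar>s\<bar> = 1"
  shows "represents N (b \<otimes> x) (c(k := c k + s)) y (max L (Suc k))"
  unfolding represents_def
proof (intro conjI allI impI)
  fix i l assume l: "max L (Suc k) \<le> l"
  then have "\<kappa> x i = ((\<Sum>m<l. c m * \<gamma> m i) + y i) mod int (u i)"
    using rep by (simp add: represents_def)
  moreover have "(\<Sum>m<l. (c(k := c k + s)) m * \<gamma> m i) = s * \<gamma> k i + (\<Sum>m<l. c m * \<gamma> m i)"
  proof -
    have "(\<Sum>m<l. (c(k := c k + s)) m * \<gamma> m i)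
      = (\<Sum>m<l. (if m = k then s * \<gamma> k i else 0) + c m * \<gamma> m i)"
      by (intro sum.cong) (auto simp: algebra_simps)
    then show ?thesis using l by (simp add: sum.distrib)
  qed
  ultimately show "\<kappa> (b \<otimes> x) i = ((\<Sum>m<l. (c(k := c k + s)) m * \<gamma> m i) + y i) mod int (u i)"
    using x b by (simp add: \<kappa>_mult mod_simps) (simp add: ac_simps)
next
  fix m
  have "\<bar>c m\<bar> \<le> int (Suc m - Suc N)" using rep by (simp add: represents_def)
  then show "\<bar>(c(k := c k + s)) m\<bar> \<le> int (Suc m - N)" using s k by (auto simp: abs_if split: if_splits)
next
  fix m
  have "card {i. i < p (Suc m) \<and> y i \<noteq> 0} \<le> Suc m - Suc N" using rep by (simp add: represents_def)
  then show "card {i. i < p (Suc m) \<and> y i \<noteq> 0} \<le> Suc m - N" by simp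
next
  fix i assume "i < p N"
  then have "i < p (Suc N)" using p_le[of N "Suc N"] by simp
  then show "y i = 0" using rep by (simp add: represents_def)
qed

lemma products_represents:
  assumes "x \<in> products \<sigma>" "\<And>l. N + l \<le> \<sigma> l"
  shows "\<exists>c y L. represents N x c y L"
  using assms
proof (induction arbitrary: N rule: products_induct)
  case (one \<sigma>)
  have "represents N \<one> (\<lambda>_. 0) (\<lambda>_. 0) 0" by (simp add: represents_def \<kappa>_one)
  then show ?case by blast
next
  case (mult b \<sigma> x)
  have "Suc N + l \<le> \<sigma> (Suc l)" for l using mult.prems[of "Suc l"] by simp
  from mult.IH[OF this] obtain c y L where rep: "represents (Suc N) x c y L" by blast
  have x: "x \<in> carrier G" using mult.hyps products_carrier by blast
  have "N \<le> \<sigma> 0" using mult.prems[of 0] by simp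
  then have "b \<in> A N" using mult.hyps A_antimono by blast
  then show ?case
  proof (cases rule: A_cases)
    case (power i k)
    then show ?thesis using represents_power[OF x rep] by blast
  next
    case (g m)
    have "represents N (b \<otimes> x) (c(m := c m + 1)) y (max L (Suc m))"
      using g by (intro represents_g[OF x rep]) (auto simp: g_carrier \<kappa>_g)
    then show ?thesis by blast
  next
    case (inv_g m)
    have "represents N (b \<otimes> x) (c(m := c m + (- 1))) y (max L (Suc m))"
      using inv_g by (intro represents_g[OF x rep]) (auto simp: g_carrier \<kappa>_g \<kappa>_inv mod_simps)
    then show ?thesis by blast
  qed
qed

text \<open>
  If the product is trivial in all high coordinates, the factors \<open>g m\<close> cancel completely.
  Otherwise take the last \<open>M\<close> for which \<open>c M\<close> does not kill the group. The
  block \<open>M\<close> has more indices than \<open>y\<close> has entries there, so \<open>y\<close>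
  vanishes at some \<open>i\<close> in it. No other \<open>g m\<close> contributes to the coordinate
  \<open>i\<close>: the later ones are killed by their exponents, and the earlier ones have their block
  and their target below \<open>i\<close>. So \<open>c M\<close> kills \<open>e i\<close>. As
  \<open>i\<close> is robust and \<open>\<bar>c M\<bar> \<le> M + 1\<close>, it kills the group.
\<close>

lemma represents_trivial_coefficients:
  assumes rep: "represents N x c y L" and x: "\<And>i. N \<le> i \<Longrightarrow> \<kappa> x i = 0"
  shows "m < L \<Longrightarrow> int (u j) dvd c m"
proof (rule ccontr)
  let ?B = "{m. m < L \<and> (\<exists>j. \<not> int (u j) dvd c m)}"
  assume "m < L" "\<not> int (u j) dvd c m"
  then have ne: "?B \<noteq> {}" by blast
  define M where "M = Max ?B"
  have "M \<in> ?B" unfolding M_def using ne by (intro Max_in) auto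
  then obtain j' where M: "M < L" "\<not> int (u j') dvd c M" by blast
  have above: "int (u i) dvd c m" if "M < m" "m < L" for m i
  proof (rule ccontr)
    assume "\<not> int (u i) dvd c m"
    then have "m \<le> M" unfolding M_def using that by (intro Max_ge) auto
    then show False using that by simp
  qed
  have cM: "\<bar>c M\<bar> \<le> int (Suc M - N)" using rep by (simp add: represents_def)
  have "c M \<noteq> 0" using M(2) by auto
  then have NM: "N \<le> M" using cM by linarith
  have "card {i. i < p (Suc M) \<and> y i \<noteq> 0} < card (block M)"
    using rep p_robust[of M] by (simp add: represents_def block_def) (meson diff_le_self le_less_trans le_trans)
  then have "\<not> block M \<subseteq> {i. i < p (Suc M) \<and> y i \<noteq> 0}"
    using card_mono[of "{i. i < p (Suc M) \<and> y i \<noteq> 0}" "block M"] by auto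
  then obtain i where i: "i \<in> block M" "i \<notin> {i. i < p (Suc M) \<and> y i \<noteq> 0}" by blast
  then have yi: "y i = 0" by (simp add: block_def)
  from i have pi: "p M < i" by (simp add: block_def)
  have "N \<le> i" using p_ge[of M] NM pi by linarith
  moreover have "\<kappa> x i = ((\<Sum>m<L. c m * \<gamma> m i) + y i) mod int (u i)"
    using rep by (simp add: represents_def)
  ultimately have "int (u i) dvd (\<Sum>m<L. c m * \<gamma> m i)"
    using x[of i] yi by (simp add: dvd_eq_mod_eq_0)
  also have "(\<Sum>m<L. c m * \<gamma> m i) = c M * \<gamma> M i + (\<Sum>m\<in>{..<L} - {M}. c m * \<gamma> m i)"
    using M(1) by (simp add: sum.remove)
  finally have sum: "int (u i) dvd c M * \<gamma> M i + (\<Sum>m\<in>{..<L} - {M}. c m * \<gamma> m i)" .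
  have "int (u i) dvd (\<Sum>m\<in>{..<L} - {M}. c m * \<gamma> m i)"
  proof (rule dvd_sum)
    fix m assume m: "m \<in> {..<L} - {M}"
    show "int (u i) dvd c m * \<gamma> m i"
    proof (cases "M < m")
      case True
      then show ?thesis using above m by simp
    next
      case False
      then have "p (Suc m) \<le> p M" "target m < i"
        using m p_le[of "Suc m" M] target_le[of m] p_ge[of M] pi by auto
      then have "\<gamma> m i = 0" using pi by (auto simp: \<gamma>_def block_def)
      then show ?thesis by simp
    qed
  qed
  then have "int (u i) dvd c M * \<gamma> M i" using sum by (simp add: dvd_add_left_iff)
  moreover have "\<gamma> M i = 1"
    using i target_le[of M] p_ge[of M] pi by (auto simp: \<gamma>_def)
  ultimately have "int (u i) dvd c M" by simp
  moreover have "i \<in> robust u M" using i by (simp add: block_def)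
  moreover have "\<bar>c M\<bar> \<le> int (Suc M)" using cM by linarith
  ultimately show False using M(2) unfolding robust_def by blast
qed

text \<open>
  If \<open>N\<close> bounds the support of \<open>x\<close> and \<open>x\<close> is a product along
  \<open>\<sigma> l = N + l\<close>, then only powers of \<open>e i\<close> with
  \<open>p N \<le> i\<close> are left after the cancellation. These have no coordinates in the support
  of \<open>x\<close>.
\<close>

lemma products_separate:
  assumes x: "x \<in> carrier G" and ne: "x \<noteq> \<one>"
  shows "\<exists>\<sigma>. x \<notin> products \<sigma>"
proof -
  obtain N where N: "\<And>i. N \<le> i \<Longrightarrow> \<kappa> x i = 0"
  proof -
    obtain N where "{i. \<kappa> x i \<noteq> 0} \<subseteq> {..<N}"
      using finite_nat_bounded[OF \<kappa>_finite[OF x]] by blast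
    then have "\<kappa> x i = 0" if "N \<le> i" for i using that by (auto simp: subset_iff)
    then show ?thesis by (rule that)
  qed
  have "x \<notin> products (\<lambda>l. N + l)"
  proof
    assume "x \<in> products (\<lambda>l. N + l)"
    then obtain c y L where rep: "represents N x c y L"
      using products_represents[of x "\<lambda>l. N + l" N] by auto
    have "\<kappa> x i = 0" for i
    proof (cases "N \<le> i")
      case False
      then have "i < p N" using p_ge[of N] by linarith
      then have "y i = 0" using rep by (simp add: represents_def)
      moreover have "int (u i) dvd (\<Sum>m<L. c m * \<gamma> m i)"
        using represents_trivial_coefficients[OF rep N] by (intro dvd_sum dvd_mult2) auto
      moreover have "\<kappa> x i = ((\<Sum>m<L. c m * \<gamma> m i) + y i) mod int (u i)"
        using rep by (simp add: represents_def)
      ultimately show ?thesis by simp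
    qed (rule N)
    then show False using \<kappa>_zero[OF x] ne by blast
  qed
  then show ?thesis by blast
qed

lemma Hausdorff: "Hausdorff_space base_topology"
  using products_separate by (rule Hausdorff_base_topology)

end

section \<open>Continuous characters and the von Neumann radical\<close>

lemma group_circle_group: "group circle_group"
proof (rule groupI)
  show "\<exists>y\<in>carrier circle_group. y \<otimes>\<^bsub>circle_group\<^esub> x = \<one>\<^bsub>circle_group\<^esub>"
    if "x \<in> carrier circle_group" for x
    using that by (intro bexI[of _ "inverse x"])
      (auto simp: circle_group_def norm_inverse intro!: left_inverse)
qed (auto simp: circle_group_def norm_mult)

lemma circle_group_one [simp]: "\<one>\<^bsub>circle_group\<^esub> = 1"
  and circle_group_mult [simp]: "x \<otimes>\<^bsub>circle_group\<^esub> y = x * y"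
  by (simp_all add: circle_group_def)

lemma circle_group_pow [simp]: "x [^]\<^bsub>circle_group\<^esub> (n :: nat) = x ^ n"
  by (induction n) (simp_all add: monoid.nat_pow_Suc[OF group.is_monoid[OF group_circle_group]]
      monoid.nat_pow_0[OF group.is_monoid[OF group_circle_group]])

text \<open>
  The powers of \<open>z\<close> have positive real parts, but those of a nontrivial root of unity add
  up to \<open>0\<close>.
\<close>

lemma root_of_unity_eq_1:
  fixes z :: complex
  assumes u: "0 < u" "z ^ u = 1" and near: "\<And>k. cmod (z ^ k - 1) < 1"
  shows "z = 1"
proof (rule ccontr)
  assume "z \<noteq> 1"
  moreover have "(z - 1) * (\<Sum>k<u. z ^ k) = 0"
    using power_diff_1_eq[of z u] u(2) by simp
  ultimately have "(\<Sum>k<u. z ^ k) = 0" by simp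
  then have "(\<Sum>k<u. Re (z ^ k)) = 0"
    by (simp flip: Re_sum)
  moreover have "0 < Re (z ^ k)" for k
    using near[of k] abs_Re_le_cmod[of "z ^ k - 1"] by simp
  then have "0 < (\<Sum>k<u. Re (z ^ k))"
    using u(1) by (intro sum_pos) auto
  ultimately show False by simp
qed

lemma cis_int_eq_1_iff:
  assumes "0 < d"
  shows "cis (2 * pi * of_int n / of_int d) = 1 \<longleftrightarrow> d dvd n"
proof
  assume "cis (2 * pi * of_int n / of_int d) = 1"
  then have "cos (2 * pi * of_int n / of_int d) = 1"
    by (metis cis.sel(1) one_complex.sel(1))
  then obtain k :: int where "2 * pi * of_int n / of_int d = of_int k * 2 * pi"
    using cos_one_2pi_int by metis
  then have "real_of_int n = of_int (k * d)" using assms by (simp add: field_simps)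
  then have "n = k * d" by (simp only: of_int_eq_iff)
  then show "d dvd n" by simp
next
  assume "d dvd n"
  then obtain k where "n = d * k" by blast
  then have "2 * pi * of_int n / of_int d = 2 * pi * of_int k" using assms by simp
  then show "cis (2 * pi * of_int n / of_int d) = 1" by simp
qed

context block_sequence
begin

lemma character_near_one:
  assumes \<xi>: "\<xi> \<in> continuous_characters G base_topology" and \<epsilon>: "0 < \<epsilon>"
  obtains n where "\<And>x. x \<in> A n \<Longrightarrow> cmod (\<xi> x - 1) < \<epsilon>"
proof -
  from \<xi> have hom: "\<xi> \<in> hom G circle_group"
    and cont: "continuous_map base_topology (top_of_set (sphere 0 1)) \<xi>"
    by (auto simp: continuous_characters_def)
  have \<xi>1: "\<xi> \<one> = 1"
    using hom_one[OF hom is_group group_circle_group] by simp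
  let ?V = "{x \<in> topspace base_topology. \<xi> x \<in> sphere 0 1 \<inter> ball 1 \<epsilon>}"
  have "openin base_topology ?V"
    using cont by (rule openin_continuous_map_preimage) (simp add: openin_open_Int)
  moreover have "\<one> \<in> ?V" using \<epsilon> by (simp add: \<xi>1)
  ultimately obtain \<sigma> where \<sigma>: "\<one> <# products \<sigma> \<subseteq> ?V"
    unfolding openin_base_topology by blast
  have "cmod (\<xi> x - 1) < \<epsilon>" if "x \<in> A (\<sigma> 0)" for x
  proof -
    have "x \<in> products \<sigma>" using A_subset_products that by blast
    moreover have "x = \<one> \<otimes> x" using that by (simp add: A_carrier)
    ultimately have "x \<in> ?V" using \<sigma> unfolding l_coset_def by blast
    then show ?thesis by (simp add: dist_norm norm_minus_commute)
  qed
  then show ?thesis by (rule that)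
qed

text \<open>
  A neighbourhood of the identity contains the cyclic groups \<open>\<langle>e i\<rangle>\<close> for
  all large \<open>i\<close>, so their images are subgroups of the circle close to \<open>1\<close> and
  hence trivial. Then \<open>g m\<close> and its target have the same image when \<open>m\<close> is
  large. Each \<open>j\<close> is the target of arbitrarily large \<open>m\<close>, so the image of
  \<open>e j [^] a j\<close> is arbitrarily close to \<open>1\<close>.
\<close>

lemma character_target:
  assumes \<xi>: "\<xi> \<in> continuous_characters G base_topology"
  shows "\<xi> (e j [^] a j) = 1"
proof -
  from \<xi> have hom: "\<xi> \<in> hom G circle_group" by (auto simp: continuous_characters_def)
  interpret \<xi>: group_hom G circle_group \<xi>
    using hom by (intro group_hom.intro is_group group_circle_group group_hom_axioms.intro)
  obtain n where n: "\<And>x. x \<in> A n \<Longrightarrow> cmod (\<xi> x - 1) < 1"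
    using character_near_one[OF \<xi>, of 1] by auto
  have \<xi>_e: "\<xi> (e i) = 1" if "p n \<le> i" for i
  proof (rule root_of_unity_eq_1)
    show "0 < u i" by (rule u_pos)
    have pow: "\<xi> (e i) ^ k = \<xi> (e i [^] int k)" for k
      using \<xi>.hom_nat_pow[of "e i" k] by (simp add: e_carrier int_pow_int)
    have "e i [^] int (u i) = \<one>"
      by (rule \<kappa>_zero) (simp_all add: e_carrier \<kappa>_pow)
    then show "\<xi> (e i) ^ u i = 1" by (simp add: pow)
    show "cmod (\<xi> (e i) ^ k - 1) < 1" for k
      unfolding pow using that by (intro n) (auto simp: A_def)
  qed
  have "cmod (\<xi> (e j [^] a j) - 1) < \<epsilon>" if "0 < \<epsilon>" for \<epsilon>
  proof -
    obtain n' where n': "\<And>x. x \<in> A n' \<Longrightarrow> cmod (\<xi> x - 1) < \<epsilon>"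
      using character_near_one[OF \<xi> \<open>0 < \<epsilon>\<close>] by blast
    define m where "m = prod_encode (j, max n n')"
    have m: "n \<le> m" "n' \<le> m" "target m = j"
      using le_prod_encode_2[of "max n n'" j] by (auto simp: m_def target_def)
    have "\<xi> (finprod G e B) = 1" if "finite B" "B \<subseteq> {p n..}" for B
      using that
      by (induction B rule: finite_induct) (auto simp: e_carrier finprod_e_carrier \<xi>_e)
    moreover have "block m \<subseteq> {p n..}"
      using p_le[OF m(1)] by (auto simp: block_def)
    ultimately have "\<xi> (finprod G e (block m)) = 1" using finite_block by blast
    then have "\<xi> (g m) = \<xi> (e j [^] a j)"
      by (simp add: g_def e_carrier finprod_e_carrier m(3))
    moreover have "g m \<in> A n'" using m(2) by (simp add: A_def)
    ultimately show ?thesis using n' by metis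
  qed
  then have "cmod (\<xi> (e j [^] a j) - 1) \<le> 0"
    by (meson less_irrefl not_le)
  then show ?thesis by simp
qed

text \<open>
  Such a homomorphism is trivial on a neighbourhood of the identity, the products along the constant
  sequence \<open>n\<close>, and so it is locally constant.
\<close>

lemma continuous_characterI:
  assumes hom: "\<xi> \<in> hom G circle_group" and one: "\<And>x. x \<in> A n \<Longrightarrow> \<xi> x = 1"
  shows "\<xi> \<in> continuous_characters G base_topology"
proof -
  have prod: "\<xi> x = 1" if "x \<in> products \<sigma>" "\<And>l. n \<le> \<sigma> l" for x \<sigma>
    using that
  proof (induction rule: products_induct)
    case (one \<sigma>)
    show ?case using hom_one[OF hom is_group group_circle_group] by simp
  next
    case (mult b \<sigma> x)
    then have "b \<in> A n" using A_antimono by blast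
    then show ?case
      using mult hom_mult[OF hom, of b x] by (simp add: A_carrier products_carrier assms(2))
  qed
  have "continuous_map base_topology (top_of_set (sphere 0 1)) \<xi>"
    unfolding continuous_map_def
  proof (intro conjI allI impI)
    show "\<xi> \<in> topspace base_topology \<rightarrow> topspace (top_of_set (sphere 0 1))"
      using hom by (auto simp: hom_def circle_group_def)
    fix V
    have "x <# products (\<lambda>_. n) \<subseteq> {x \<in> topspace base_topology. \<xi> x \<in> V}"
      if "x \<in> carrier G" "\<xi> x \<in> V" for x
      using that hom_mult[OF hom, of x] prod[of _ "\<lambda>_. n"]
      by (auto simp: l_coset_def products_carrier)
    then show "openin base_topology {x \<in> topspace base_topology. \<xi> x \<in> V}"
      unfolding openin_base_topology by auto
  qed
  then show ?thesis using hom by (simp add: continuous_characters_def)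
qed

text \<open>
  With \<open>d = gcd (a i) (u i)\<close>, the character is
  \<open>x \<mapsto> cis (2 \<pi> \<kappa> x i / d)\<close>. It is a homomorphism because
  \<open>d\<close> divides \<open>u i\<close>. It is trivial on \<open>A (Suc i)\<close>, and thus
  continuous, because the elements of this set have multiples of \<open>a i\<close> modulo
  \<open>u i\<close> as their coordinate at \<open>i\<close>.
\<close>

lemma coordinate_character:
  obtains \<xi> where "\<xi> \<in> continuous_characters G base_topology"
    and "\<And>x. \<xi> x = 1 \<longleftrightarrow> gcd (a i) (int (u i)) dvd \<kappa> x i"
proof -
  define d where "d = gcd (a i) (int (u i))"
  have d: "0 < d" "d dvd a i" "d dvd int (u i)" using u_pos[of i] by (auto simp: d_def)
  define \<xi> where "\<xi> x = cis (2 * pi * of_int (\<kappa> x i) / of_int d)" for x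
  have \<xi>1: "\<xi> x = 1 \<longleftrightarrow> d dvd \<kappa> x i" for x
    unfolding \<xi>_def using d(1) by (rule cis_int_eq_1_iff)
  have "\<xi> \<in> hom G circle_group"
  proof (rule homI)
    show "\<xi> x \<in> carrier circle_group" for x by (simp add: \<xi>_def circle_group_def)
    fix x y assume xy: "x \<in> carrier G" "y \<in> carrier G"
    let ?n = "\<kappa> x i + \<kappa> y i" and ?m = "\<kappa> (x \<otimes> y) i"
    have "d dvd ?n - ?m"
      using xy d(3) by (simp add: \<kappa>_mult) (metis dvd_minus_mod dvd_trans)
    then have "cis (2 * pi * of_int (?n - ?m) / of_int d) = 1"
      using cis_int_eq_1_iff[OF d(1)] by blast
    moreover have "\<xi> x * \<xi> y = cis (2 * pi * of_int (?n - ?m) / of_int d) * \<xi> (x \<otimes> y)"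
      unfolding \<xi>_def cis_mult by (rule arg_cong[of _ _ cis]) (simp add: field_simps add_divide_distrib[symmetric])
    ultimately show "\<xi> (x \<otimes> y) = \<xi> x \<otimes>\<^bsub>circle_group\<^esub> \<xi> y" by simp
  qed
  moreover have "\<xi> x = 1" if "x \<in> A (Suc i)" for x
    using that
  proof (cases rule: A_cases)
    case (power k n)
    then have "k \<noteq> i" using p_ge[of "Suc i"] by linarith
    then show ?thesis by (simp add: \<xi>1 power \<kappa>_pow)
  next
    case (g m)
    then have "i < p m" using p_ge[of m] by linarith
    then have "d dvd \<gamma> m i" using d(2) by (auto simp: \<gamma>_def block_def)
    then show ?thesis using d(3) by (simp add: \<xi>1 g \<kappa>_g dvd_mod)
  next
    case (inv_g m)
    then have "i < p m" using p_ge[of m] by linarith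
    then have "d dvd \<gamma> m i" using d(2) by (auto simp: \<gamma>_def block_def)
    then show ?thesis using d(3) by (simp add: \<xi>1 inv_g \<kappa>_inv g_carrier \<kappa>_g dvd_mod)
  qed
  ultimately have "\<xi> \<in> continuous_characters G base_topology" by (rule continuous_characterI)
  then show ?thesis using that \<xi>1 unfolding d_def by blast
qed

text \<open>
  The hypotheses describe the direct sum of the cyclic groups generated by the
  \<open>e j [^] a j\<close>, once by its coordinates and once by its minimality.
\<close>

lemma von_Neumann_radical_base_topology:
  assumes H: "H = {x \<in> carrier G. \<forall>i. gcd (a i) (int (u i)) dvd \<kappa> x i}"
    and sub: "\<And>K. subgroup K G \<Longrightarrow> (\<And>j. e j [^] a j \<in> K) \<Longrightarrow> H \<subseteq> K"
  shows "von_Neumann_radical G base_topology = H"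
proof
  show "H \<subseteq> von_Neumann_radical G base_topology"
    unfolding von_Neumann_radical_def
  proof (rule INT_greatest)
    fix \<xi> assume \<xi>: "\<xi> \<in> continuous_characters G base_topology"
    then have "\<xi> \<in> hom G circle_group" by (auto simp: continuous_characters_def)
    then interpret \<xi>: group_hom G circle_group \<xi>
      by (intro group_hom.intro is_group group_circle_group group_hom_axioms.intro)
    show "H \<subseteq> kernel G circle_group \<xi>"
      by (rule sub[OF \<xi>.subgroup_kernel]) (simp add: kernel_def e_carrier character_target[OF \<xi>])
  qed
  show "von_Neumann_radical G base_topology \<subseteq> H"
  proof
    fix x assume x: "x \<in> von_Neumann_radical G base_topology"
    have "x \<in> carrier G \<and> gcd (a i) (int (u i)) dvd \<kappa> x i" for i
    proof -
      obtain \<xi> where "\<xi> \<in> continuous_characters G base_topology"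
        and "\<And>x. \<xi> x = 1 \<longleftrightarrow> gcd (a i) (int (u i)) dvd \<kappa> x i"
        using coordinate_character by blast
      then show ?thesis using x by (auto simp: von_Neumann_radical_def kernel_def)
    qed
    then show "x \<in> H" by (auto simp: H)
  qed
qed

end

section \<open>A topology with prescribed von Neumann radical\<close>

theorem proposition3:
  fixes G :: "('a, 'b) monoid_scheme"
    and e e' :: "nat \<Rightarrow> 'a"
    and u :: "nat \<Rightarrow> nat"
    and H :: "'a set"
  assumes "comm_group G"
    and "\<And>j. e j \<in> carrier G"
    and "internal_direct_sum G UNIV (\<lambda>j. generate G {e j}) (carrier G)"
    and "\<And>j. u j = group.ord G (e j)"
    and "\<And>j. 0 < u j" \<comment> \<open>\<open>group.ord\<close> is 0 on elements of infinite order\<close>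
    and "\<And>j. e' j \<in> generate G {e j}"
    and "internal_direct_sum G UNIV (\<lambda>j. generate G {e' j}) H"
    and "(\<exists>j0. (\<forall>j\<ge>j0. u j = u j0) \<and> (\<forall>j<j0. u j dvd u j0)) \<or> \<not> bdd_above (range u)"
  shows "\<exists>T. topological_group G T \<and> Hausdorff_space T \<and> complete_group_topology G T \<and>
    von_Neumann_radical G T = H"
proof -
  interpret G: comm_group G by fact
  note e = assms(2) and u_ord = assms(4) and u_pos = assms(5)
  have gen: "generate G {x} = range (\<lambda>n :: int. x [^]\<^bsub>G\<^esub> n)" if "x \<in> carrier G" for x
    using G.generate_pow[OF that] by auto
  obtain \<pi> where \<pi>_hom: "\<And>i. \<pi> i \<in> hom G G"
    and \<pi>_in: "\<And>i x. x \<in> carrier G \<Longrightarrow> \<pi> i x \<in> generate G {e i}"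
    and \<pi>_single: "\<And>i j x. x \<in> generate G {e i} \<Longrightarrow> \<pi> j x = (if j = i then x else \<one>\<^bsub>G\<^esub>)"
    and \<pi>_finite: "\<And>x. x \<in> carrier G \<Longrightarrow> finite {i. \<pi> i x \<noteq> \<one>\<^bsub>G\<^esub>}"
    and \<pi>_prod: "\<And>x. x \<in> carrier G \<Longrightarrow> x = gfinprod G (\<lambda>i. \<pi> i x) UNIV"
    by (rule G.internal_direct_sum_projections[OF assms(3)], rule that)
  have pow_eq: "e i [^]\<^bsub>G\<^esub> (k :: int) = e i [^]\<^bsub>G\<^esub> l \<longleftrightarrow> k mod int (u i) = l mod int (u i)" for i k l
    using G.int_pow_eq[OF e] by (metis mod_eq_dvd_iff u_ord)
  define \<kappa> where "\<kappa> x i = (SOME k :: int. \<pi> i x = e i [^]\<^bsub>G\<^esub> k) mod int (u i)" for x i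
  have \<kappa>: "\<kappa> x i = k mod int (u i)" if "\<pi> i x = e i [^]\<^bsub>G\<^esub> k" for x i k
    unfolding \<kappa>_def using that someI[of "\<lambda>k. \<pi> i x = e i [^]\<^bsub>G\<^esub> k" k] by (metis pow_eq)
  have \<pi>\<kappa>: "\<pi> i x = e i [^]\<^bsub>G\<^esub> \<kappa> x i" if x: "x \<in> carrier G" for x i
  proof -
    obtain k :: int where "\<pi> i x = e i [^]\<^bsub>G\<^esub> k" using \<pi>_in[OF x] gen[OF e] by blast
    with \<kappa>[OF this] show ?thesis by (metis pow_eq mod_mod_trivial)
  qed
  interpret coordinates G e u \<kappa>
  proof
    show "e i \<in> carrier G" "0 < u i" for i by (fact e u_pos)+
    show "\<kappa> (x \<otimes>\<^bsub>G\<^esub> y) i = (\<kappa> x i + \<kappa> y i) mod int (u i)"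
      if "x \<in> carrier G" "y \<in> carrier G" for x y i
      using that hom_mult[OF \<pi>_hom, of x y i] by (intro \<kappa>) (simp add: \<pi>\<kappa> G.int_pow_mult e)
    show "\<kappa> (e j [^]\<^bsub>G\<^esub> (n :: int)) i = (if i = j then n mod int (u i) else 0)" for j n i
    proof -
      have "\<pi> i (e j [^]\<^bsub>G\<^esub> n) = (if i = j then e j [^]\<^bsub>G\<^esub> n else \<one>\<^bsub>G\<^esub>)"
        using \<pi>_single gen[OF e] by blast
      then show ?thesis
        using \<kappa>[of i "e j [^]\<^bsub>G\<^esub> n" n] \<kappa>[of i "e j [^]\<^bsub>G\<^esub> n" 0] by (cases "i = j") simp_all
    qed
    show "\<kappa> x i mod int (u i) = \<kappa> x i" for x i by (simp add: \<kappa>_def)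
    show "finite {i. \<kappa> x i \<noteq> 0}" if "x \<in> carrier G" for x
    proof (rule finite_subset[OF _ \<pi>_finite[OF that]])
      show "{i. \<kappa> x i \<noteq> 0} \<subseteq> {i. \<pi> i x \<noteq> \<one>\<^bsub>G\<^esub>}" using \<kappa>[of _ x 0] by auto
    qed
    show "x = \<one>\<^bsub>G\<^esub>" if "x \<in> carrier G" "\<And>i. \<kappa> x i = 0" for x
      using \<pi>_prod[OF that(1)] that by (simp add: \<pi>\<kappa> gfinprod_def)
  qed
  have "\<forall>j. \<exists>k :: int. e' j = e j [^]\<^bsub>G\<^esub> k" using assms(6) gen[OF e] by blast
  then obtain a :: "nat \<Rightarrow> int" where a: "\<And>j. e' j = e j [^]\<^bsub>G\<^esub> a j" by metis
  obtain p where p: "p 0 = 0" "strict_mono p" "\<And>m. Suc m < card (robust u m \<inter> {p m<..<p (Suc m)})"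
    using exists_block_bounds infinite_robust[OF assms(8)] by metis
  interpret block_sequence G e u \<kappa> a p
    using p by unfold_locales
  have e': "e' j \<in> carrier G" for j by (simp add: a e)
  have H_image: "H = (\<lambda>x. gfinprod G x UNIV) ` {x. (\<forall>i. x i \<in> generate G {e' i}) \<and> finite {i. x i \<noteq> \<one>\<^bsub>G\<^esub>}}"
  proof -
    have "group (G\<lparr>carrier := generate G {e' i}\<rparr>)" for i
      using e' by (intro subgroup.subgroup_is_group G.generate_is_subgroup) auto
    then have "carrier (sum_group UNIV (\<lambda>i. G\<lparr>carrier := generate G {e' i}\<rparr>))
        = {x. (\<forall>i. x i \<in> generate G {e' i}) \<and> finite {i. x i \<noteq> \<one>\<^bsub>G\<^esub>}}"
      by (subst carrier_sum_group) auto
    then show ?thesis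
      using assms(7) by (auto simp: internal_direct_sum_def iso_def bij_betw_def)
  qed
  have sub: "H \<subseteq> K" if K: "subgroup K G" "\<And>j. e j [^]\<^bsub>G\<^esub> a j \<in> K" for K
  proof -
    have "generate G {e' i} \<subseteq> K" for i
      using K by (intro G.generate_subgroup_incl) (auto simp: a)
    then show ?thesis
      unfolding H_image by (intro image_subsetI G.gfinprod_in_subgroup[OF K(1)]) blast
  qed
  have "H = {x \<in> carrier G. \<forall>i. gcd (a i) (int (u i)) dvd \<kappa> x i}" (is "_ = ?K")
  proof
    have "subgroup ?K G"
      by (rule subgroup.intro) (auto simp: \<kappa>_mult \<kappa>_inv \<kappa>_one intro!: dvd_mod dvd_add)
    then show "H \<subseteq> ?K" by (rule sub) (auto simp: \<kappa>_pow e dvd_mod)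
    show "?K \<subseteq> H"
    proof
      fix x assume x: "x \<in> ?K"
      have "\<pi> i x \<in> generate G {e' i}" for i
      proof -
        obtain t where t: "\<kappa> x i = gcd (a i) (int (u i)) * t" using x by blast
        \<comment> \<open>Modulo \<open>u i\<close>, the multiples of \<open>gcd (a i) (u i)\<close> are those of \<open>a i\<close>.\<close>
        obtain r s where "r * a i + s * int (u i) = gcd (a i) (int (u i))" using bezout_int by blast
        then have "\<kappa> x i = (r * a i + s * int (u i)) * t" using t by simp
        then have "\<kappa> x i = a i * (r * t) + int (u i) * (s * t)" by (simp add: algebra_simps)
        then have "\<pi> i x = e' i [^]\<^bsub>G\<^esub> (r * t)"
          using x by (simp add: \<pi>\<kappa> a G.int_pow_pow e pow_eq)
        then show ?thesis using gen[OF e'] by blast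
      qed
      then show "x \<in> H"
        unfolding H_image using x \<pi>_prod[of x] \<pi>_finite[of x]
        by (intro image_eqI[of _ _ "\<lambda>i. \<pi> i x"]) simp_all
    qed
  qed
  then have "von_Neumann_radical G base_topology = H"
    using sub by (rule von_Neumann_radical_base_topology)
  then show ?thesis
    using topological_group_base_topology Hausdorff complete by blast
qed

end
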